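(* Let $A\in\mathbb{R}^{n\times n}$, $B\in\mathbb{R}^{n\times m}$ with $(A,B)$ controllable and $B$ of full column rank, let $T>0$ and let $K(t)$, $t\in[0,T]$, be a feedback matrix. Assume $\bar Q\in\mathbb{S}_+^n$ is a feasible solution of the inverse LQ problem for $K$, i.e. $\bar Q\in\mathcal{D}_{K+}$, and let $r=\frac{(n-m)(n-m+1)}{2}$. Then the solution space of $Q$ has the following properties: (1) $\mathcal{D}_{K+}$ is a closed and bounded convex set with dimension $r$. For any $Q_1,Q_2\in\mathcal{D}_{K+}$ with $Q_1\neq Q_2$, the matrix $\Delta Q=Q_1-Q_2$ must be indefinite, with eigenvalues on both sides of the imaginary axis. (2) If $\bar Q=0$ is a feasible solution, then it is the unique solution to the inverse LQ problem. (3) If $\bar Q\succ 0$, then there must exist an infinite number of solutions. (4) If $\bar Q$ is on the boundary of $\mathbb{S}_+^n$ (i.e. $\mathrm{rank}(\bar Q)<n$), uniqueness of the solution depends on the specific position of $\bar Q$. A sufficient condition for $\bar Q$ to be the unique solution is the following. Let $\{\Delta Q_1,\dots,\Delta Q_r\}$ be a basis of the subspace $\mathcal{S}$, and let $X^*$ be a non-zero optimal solution of $$\min_X\ \mathrm{tr}(\bar QX)\quad\text{s.t.}\quad \mathrm{tr}(\Delta Q_iX)=0\ (i=1,\dots,r),\quad X\succeq 0,$$ written as $X^*=V\,\mathrm{diag}(\lambda_1,\dots,\lambda_l,0,\dots,0)\,V^T$ for some unitary matrix $V$, with $l=\mathrm{rank}(X^* )$. Put $$\mathcal{T}=\left\{V\begin{bmatrix}0&0\\0&W\end{bmatrix}V^T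 : W\in\mathbb{S}^{n-l}\right\}.$$ If $\mathcal{T}\cap\mathcal{S}=\{0\}$, then $\bar Q$ is the unique solution to the inverse LQ problem.
   Context: $\mathbb{S}^n$ is the space of real symmetric $n\times n$ matrices, $\mathbb{S}_+^n$ the cone of positive semidefinite ones. For $Q,F\in\mathbb{S}_+^n$ let $P(t)$ be the solution on $[0,T]$ of the differential Riccati equation $-\dot P=PA+A^TP-PBB^TP+Q$, $P(T)=F$. The finite-horizon LQ problem of minimizing $x^T(T)Fx(T)+\int_0^T(x^TQx+u^Tu)\,dt$ subject to $\dot x=Ax+Bu$ with given initial state has optimal feedback $u=K(t)x$ with $K(t)=-B^TP(t)$; write $K=\mathrm{DRE}\{Q,F\}$ in this case. The inverse LQ problem for $K$ asks for $Q$ (with a corresponding $F$) generating $K$; its solution space is $$\mathcal{D}_{K+}=\{Q\in\mathbb{S}_+^n : K=\mathrm{DRE}\{Q,F\}\text{ for some }F\in\mathbb{S}_+^n\}.$$ Further, $$\mathcal{S}=\{\Delta Q:\ \exists\,\Delta P\in\mathbb{S}^n\text{ with }A^T\Delta P+\Delta P A+\Delta Q=0,\ B^T\Delta P=0\},$$ a linear subspace of $\mathbb{S}^n$ of dimension $r$.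
   Formalization: In (1), "dimension r" fails for Q̄=0, m<n; stated instead: D_{K+} lies in Q̄+S with dim S=r, has dimension at most r, and exactly r if it contains a positive definite matrix. (3) assumes m<n (it fails for m=n). "Depends on position" in (4) is shown by instances with varying K. *)

theory Defs
  imports "HOL-Analysis.Analysis"
begin

definition sym_mats :: "(real ^ 'n ^ 'n) set" where
  "sym_mats = {M. transpose M = M}"

definition psd_mats :: "(real ^ 'n ^ 'n) set" where
  "psd_mats = {M \<in> sym_mats. \<forall>x. 0 \<le> x \<bullet> (M *v x)}"

definition pos_def :: "real ^ 'n ^ 'n \<Rightarrow> bool" where
  "pos_def M \<longleftrightarrow> M \<in> sym_mats \<and> (\<forall>x. x \<noteq> 0 \<longrightarrow> 0 < x \<bullet> (M *v x))"

definition indefinite :: "real ^ 'n ^ 'n \<Rightarrow> bool" where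
  "indefinite M \<longleftrightarrow> M \<in> sym_mats \<and> (\<exists>x. 0 < x \<bullet> (M *v x)) \<and> (\<exists>y. y \<bullet> (M *v y) < 0)"

definition eigenvalue :: "real ^ 'n ^ 'n \<Rightarrow> real \<Rightarrow> bool" where
  "eigenvalue M c \<longleftrightarrow> (\<exists>v. v \<noteq> 0 \<and> M *v v = c *\<^sub>R v)"

definition diag_mat :: "('n \<Rightarrow> real) \<Rightarrow> real ^ 'n ^ 'n" where
  "diag_mat d = (\<chi> i j. if i = j then d i else 0)"

text \<open>
  An \<open>n \<times> m\<close> matrix has type \<^typ>\<open>real ^ 'm ^ 'n\<close>. The union below consists of the columns
  of the Kalman matrix \<open>[B, A B, \<dots>, A\<^sup>n\<^sup>-\<^sup>1 B]\<close>, so its dimension is the rank of that matrix.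
\<close>

definition controllable :: "real ^ 'n ^ 'n \<Rightarrow> real ^ 'm ^ 'n \<Rightarrow> bool" where
  "controllable A B \<longleftrightarrow>
     dim (\<Union>k < CARD('n). columns (((\<lambda>M. A ** M) ^^ k) B)) = CARD('n)"

definition solves_DRE ::
  "real ^ 'n ^ 'n \<Rightarrow> real ^ 'm ^ 'n \<Rightarrow> real \<Rightarrow> real ^ 'n ^ 'n \<Rightarrow> real ^ 'n ^ 'n
     \<Rightarrow> (real \<Rightarrow> real ^ 'n ^ 'n) \<Rightarrow> bool" where
  "solves_DRE A B T Q F P \<longleftrightarrow>
     (\<forall>t \<in> {0..T}.
        (P has_vector_derivative
           - (P t ** A + transpose A ** P t - P t ** B ** transpose B ** P t + Q))
        (at t within {0..T})) \<and>
     P T = F"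

text \<open>
  \<open>is_DRE A B T Q F K\<close> expresses \<open>K = DRE{Q, F}\<close> on \<open>[0, T]\<close>; values of \<open>K\<close> outside the horizon are
  irrelevant. The right-hand side of the Riccati equation is locally Lipschitz, so the solution on
  \<open>[0, T]\<close> is unique there and the existential quantifier picks the solution.
\<close>

definition is_DRE ::
  "real ^ 'n ^ 'n \<Rightarrow> real ^ 'm ^ 'n \<Rightarrow> real \<Rightarrow> real ^ 'n ^ 'n \<Rightarrow> real ^ 'n ^ 'n
     \<Rightarrow> (real \<Rightarrow> real ^ 'n ^ 'm) \<Rightarrow> bool" where
  "is_DRE A B T Q F K \<longleftrightarrow>
     (\<exists>P. solves_DRE A B T Q F P \<and> (\<forall>t \<in> {0..T}. K t = - (transpose B ** P t)))"

definition solution_space ::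
  "real ^ 'n ^ 'n \<Rightarrow> real ^ 'm ^ 'n \<Rightarrow> real \<Rightarrow> (real \<Rightarrow> real ^ 'n ^ 'm)
     \<Rightarrow> (real ^ 'n ^ 'n) set" where
  "solution_space A B T K = {Q \<in> psd_mats. \<exists>F \<in> psd_mats. is_DRE A B T Q F K}"

definition difference_space ::
  "real ^ 'n ^ 'n \<Rightarrow> real ^ 'm ^ 'n \<Rightarrow> (real ^ 'n ^ 'n) set" where
  "difference_space A B =
     {\<Delta>Q. \<exists>\<Delta>P \<in> sym_mats. transpose A ** \<Delta>P + \<Delta>P ** A + \<Delta>Q = 0 \<and> transpose B ** \<Delta>P = 0}"

definition is_basis :: "nat \<Rightarrow> (nat \<Rightarrow> real ^ 'n ^ 'n) \<Rightarrow> (real ^ 'n ^ 'n) set \<Rightarrow> bool" where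
  "is_basis r G S \<longleftrightarrow> inj_on G {1..r} \<and> independent (G ` {1..r}) \<and> span (G ` {1..r}) = S"

definition sdp_feasible :: "nat \<Rightarrow> (nat \<Rightarrow> real ^ 'n ^ 'n) \<Rightarrow> (real ^ 'n ^ 'n) set" where
  "sdp_feasible r G = {X \<in> psd_mats. \<forall>i \<in> {1..r}. trace (G i ** X) = 0}"

definition sdp_optimal ::
  "real ^ 'n ^ 'n \<Rightarrow> nat \<Rightarrow> (nat \<Rightarrow> real ^ 'n ^ 'n) \<Rightarrow> real ^ 'n ^ 'n \<Rightarrow> bool" where
  "sdp_optimal C r G X \<longleftrightarrow>
     X \<in> sdp_feasible r G \<and> (\<forall>Y \<in> sdp_feasible r G. trace (C ** X) \<le> trace (C ** Y))"

text \<open>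
  The index type carries no order, so the positions of the leading block \<open>1, \<dots>, l\<close> are given by a set
  \<open>I\<close> of \<open>l\<close> indices. The block matrix with blocks \<open>0, 0, 0, W\<close> and symmetric \<open>W\<close> of size \<open>n - l\<close> is
  then a symmetric matrix whose entries vanish whenever the row or the column index lies in \<open>I\<close>.
\<close>

definition block_space :: "real ^ 'n ^ 'n \<Rightarrow> 'n set \<Rightarrow> (real ^ 'n ^ 'n) set" where
  "block_space V I =
     {V ** M ** transpose V | M. M \<in> sym_mats \<and> (\<forall>i j. i \<in> I \<or> j \<in> I \<longrightarrow> M $ i $ j = 0)}"

end

(* If two solutions P1, P2 of the Riccati equation yield the same feedback, then B\<^sup>T (P1 - P2) = 0, the
   quadratic terms cancel, and controllability forces N = P1 - P2 to be constant. Hence the solution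
   space consists of the Q + lyap A N with N in null_sym B = {N symmetric. B\<^sup>T N = 0} for which both
   Q + lyap A N and F + N are positive semidefinite.

   If N is in null_sym B and lyap A N is positive semidefinite, then the kernel of N is A-invariant and
   contains the range of B, so N = 0. This gives indefiniteness of differences, boundedness (there is no
   recession direction) and the injectivity of lyap A on null_sym B. The space null_sym B is spanned by
   the dyads w w\<^sup>T with B\<^sup>T w = 0, and adding such a dyad keeps F positive semidefinite; so near a
   positive definite Q the solution space contains a full-dimensional cone even if F is singular. *)

theory Submission
  imports Defs
begin

section \<open>Symmetric and positive semidefinite matrices\<close>

text \<open>The quadratic terms cancel only because equality of the \<open>transpose B ** P\<close>
  can be transposed, which needs symmetric Riccati solutions. \<open>solves_DRE\<close> does not
  demand symmetry; it is recovered from the symmetric data by a Gronwall estimate run backwards from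
  \<open>T\<close>.

  Of the spectral theorem only extremal eigenvectors are required. They come from maximizing the
  quadratic form on the unit sphere, since a null vector of a psd form lies in the kernel of its
  matrix. The full decomposition of the optimal \<open>X\<close> is part of the data of the
  certificate.

  That uniqueness at a singular weight depends on its position calls for examples of both kinds.
  Zero weight with zero feedback gives uniqueness. For the opposite, a constant Riccati solution
  supplies a positive definite weight, which is then moved along some
  \<open>lyap A (dyad w w)\<close> to the boundary of the cone: the weight reached is singular, and
  the one left behind generates the same feedback.\<close>

lemma bounded_bilinear_matrix_mult:
  "bounded_bilinear ((**) :: real^'m^'n \<Rightarrow> real^'p^'m \<Rightarrow> real^'p^'n)"
  unfolding bilinear_conv_bounded_bilinear [symmetric] bilinear_def
  by (auto intro!: linearI simp: matrix_matrix_mult_def vec_eq_iff sum.distrib sum_distrib_left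
      algebra_simps)

lemma bounded_bilinear_matrix_vector_mult:
  "bounded_bilinear ((*v) :: real^'m^'n \<Rightarrow> real^'m \<Rightarrow> real^'n)"
  unfolding bilinear_conv_bounded_bilinear [symmetric] bilinear_def
  by (auto intro!: linearI simp: matrix_vector_mult_def vec_eq_iff sum.distrib sum_distrib_left
      algebra_simps)

lemmas matrix_mult_bilinear =
  bounded_bilinear.add_left [OF bounded_bilinear_matrix_mult]
  bounded_bilinear.add_right [OF bounded_bilinear_matrix_mult]
  bounded_bilinear.diff_left [OF bounded_bilinear_matrix_mult]
  bounded_bilinear.diff_right [OF bounded_bilinear_matrix_mult]
  bounded_bilinear.minus_left [OF bounded_bilinear_matrix_mult]
  bounded_bilinear.minus_right [OF bounded_bilinear_matrix_mult]
  bounded_bilinear.scaleR_left [OF bounded_bilinear_matrix_mult]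
  bounded_bilinear.scaleR_right [OF bounded_bilinear_matrix_mult]
  bounded_bilinear.zero_left [OF bounded_bilinear_matrix_mult]
  bounded_bilinear.zero_right [OF bounded_bilinear_matrix_mult]

lemmas matrix_vector_mult_bilinear =
  bounded_bilinear.add_left [OF bounded_bilinear_matrix_vector_mult]
  bounded_bilinear.add_right [OF bounded_bilinear_matrix_vector_mult]
  bounded_bilinear.diff_left [OF bounded_bilinear_matrix_vector_mult]
  bounded_bilinear.diff_right [OF bounded_bilinear_matrix_vector_mult]
  bounded_bilinear.minus_left [OF bounded_bilinear_matrix_vector_mult]
  bounded_bilinear.minus_right [OF bounded_bilinear_matrix_vector_mult]
  bounded_bilinear.scaleR_left [OF bounded_bilinear_matrix_vector_mult]
  bounded_bilinear.scaleR_right [OF bounded_bilinear_matrix_vector_mult]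
  bounded_bilinear.zero_left [OF bounded_bilinear_matrix_vector_mult]
  bounded_bilinear.zero_right [OF bounded_bilinear_matrix_vector_mult]

lemma bounded_linear_transpose: "bounded_linear (transpose :: real^'m^'n \<Rightarrow> real^'n^'m)"
  unfolding linear_conv_bounded_linear [symmetric]
  by (auto intro!: linearI simp: transpose_def vec_eq_iff)

lemmas transpose_linear =
  linear_add [OF bounded_linear.linear [OF bounded_linear_transpose]]
  linear_diff [OF bounded_linear.linear [OF bounded_linear_transpose]]
  linear_neg [OF bounded_linear.linear [OF bounded_linear_transpose]]
  linear_cmul [OF bounded_linear.linear [OF bounded_linear_transpose]]
  linear_0 [OF bounded_linear.linear [OF bounded_linear_transpose]]

lemma inner_transpose: "transpose X \<bullet> transpose Y = X \<bullet> (Y :: real^'m^'n)"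
  unfolding inner_vec_def transpose_def by (simp add: sum.swap [of _ "UNIV :: 'm set"])

section \<open>The cone of positive semidefinite matrices\<close>

lemma subspace_sym_mats: "subspace sym_mats"
  by (auto simp: subspace_def sym_mats_def transpose_linear)

lemma sym_mats_inner_commute:
  assumes "M \<in> sym_mats"
  shows "x \<bullet> (M *v y) = y \<bullet> (M *v x)"
proof -
  have "x \<bullet> (M *v y) = (transpose M *v x) \<bullet> y"
    by (simp add: dot_lmul_matrix)
  also have "transpose M *v x = M *v x"
    using assms by (simp only: sym_mats_def mem_Collect_eq)
  finally show ?thesis
    by (simp add: inner_commute)
qed

lemma psd_mats_sym: "M \<in> psd_mats \<Longrightarrow> M \<in> sym_mats"
  by (simp add: psd_mats_def)

lemma psd_mats_add: "M \<in> psd_mats \<Longrightarrow> N \<in> psd_mats \<Longrightarrow> M + N \<in> psd_mats"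
  using subspace_add [OF subspace_sym_mats]
  by (auto simp: psd_mats_def matrix_vector_mult_bilinear inner_add_right)

lemma psd_mats_scaleR: "M \<in> psd_mats \<Longrightarrow> 0 \<le> c \<Longrightarrow> c *\<^sub>R M \<in> psd_mats"
  using subspace_scale [OF subspace_sym_mats]
  by (auto simp: psd_mats_def matrix_vector_mult_bilinear)

lemma zero_in_psd_mats: "0 \<in> psd_mats"
  by (simp add: psd_mats_def sym_mats_def transpose_linear)

lemma convex_psd_mats: "convex psd_mats"
  unfolding convex_def by (blast intro: psd_mats_add psd_mats_scaleR)

lemma closed_psd_mats: "closed (psd_mats :: (real^'n^'n) set)"
proof -
  have "psd_mats = sym_mats \<inter> (\<Inter>x. {M :: real^'n^'n. 0 \<le> x \<bullet> (M *v x)})"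
    by (auto simp: psd_mats_def)
  moreover have closed: "closed {M :: real^'n^'n. 0 \<le> x \<bullet> (M *v x)}" for x
    by (intro closed_Collect_le continuous_intros
        bounded_bilinear.continuous_on [OF bounded_bilinear_matrix_vector_mult])
  have "closed (sym_mats \<inter> (\<Inter>x. {M :: real^'n^'n. 0 \<le> x \<bullet> (M *v x)}))"
    by (intro closed_Int closed_INT ballI closed closed_subspace [OF subspace_sym_mats])
  ultimately show ?thesis
    by (rule ssubst)
qed

lemma pos_def_imp_psd: "pos_def M \<Longrightarrow> M \<in> psd_mats"
  by (clarsimp simp: pos_def_def psd_mats_def)
    (metis inner_zero_left less_eq_real_def)

text \<open>If \<open>y = M *v x\<close> were nonzero, a small step from \<open>x\<close> against
  \<open>y\<close> would make the form negative: its value at \<open>x - t y\<close> is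
  \<open>t * (t * b - 2 * (y \<bullet> y))\<close>.\<close>

lemma psd_mats_null:
  assumes M: "M \<in> psd_mats" and x: "x \<bullet> (M *v x) = 0"
  shows "M *v x = 0"
proof (rule ccontr)
  assume nz: "M *v x \<noteq> 0"
  define y where "y = M *v x"
  define b where "b = y \<bullet> (M *v y)"
  have "0 \<le> b"
    using M by (simp add: b_def psd_mats_def)
  \<comment> \<open>Small enough for \<open>t * b \<le> y \<bullet> y\<close>; the summand 1 keeps
    the denominator positive when \<open>b = 0\<close>.\<close>
  define t where "t = (y \<bullet> y) / (b + 1)"
  have pos: "0 < y \<bullet> y" and t: "0 < t"
    using nz \<open>0 \<le> b\<close> by (simp_all add: y_def t_def)
  have "0 \<le> (x - t *\<^sub>R y) \<bullet> (M *v (x - t *\<^sub>R y))"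
    using M by (simp add: psd_mats_def)
  also have "\<dots> = - 2 * t * (y \<bullet> y) + t\<^sup>2 * b"
    using x sym_mats_inner_commute [OF psd_mats_sym [OF M], of x y]
    by (simp add: matrix_vector_mult_bilinear inner_diff_left inner_diff_right b_def
        power2_eq_square algebra_simps flip: y_def)
  also have "\<dots> = t * (t * b - 2 * (y \<bullet> y))"
    by (simp add: power2_eq_square algebra_simps)
  finally have "2 * (y \<bullet> y) \<le> t * b"
    using t by (simp add: zero_le_mult_iff)
  moreover have "t * b \<le> y \<bullet> y"
    using pos \<open>0 \<le> b\<close> by (simp add: t_def field_simps)
  ultimately show False
    using pos by simp
qed

lemma psd_not_pos_def_rank:
  fixes M :: "real^'n^'n"
  assumes "M \<in> psd_mats" "\<not> pos_def M"
  shows "rank M < CARD('n)"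
proof -
  obtain x where "x \<noteq> 0" "x \<bullet> (M *v x) \<le> 0"
    using assms by (auto simp: pos_def_def psd_mats_def not_less)
  then have "M *v x = 0"
    using assms psd_mats_null by (force simp: psd_mats_def intro: antisym)
  with \<open>x \<noteq> 0\<close> show ?thesis
    using less_rank_noninjective [of M] matrix_vector_mult_0_right [of M]
    by (metis injD)
qed

text \<open>Compactness of the unit sphere provides a maximizer \<open>v\<close> with value
  \<open>c\<close>. Then \<open>c *\<^sub>R mat 1 - M\<close> is psd and its form vanishes at
  \<open>v\<close>, so \<open>psd_mats_null\<close> yields the eigenvector equation without Lagrange
  multipliers.\<close>

lemma rayleigh_max_eigenvector:
  fixes M :: "real^'n^'n"
  assumes "M \<in> sym_mats"
  obtains v where "norm v = 1" "\<And>x. x \<bullet> (M *v x) \<le> (v \<bullet> (M *v v)) * (x \<bullet> x)"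
    "M *v v = (v \<bullet> (M *v v)) *\<^sub>R v"
proof -
  have "continuous_on (sphere 0 1) (\<lambda>x. x \<bullet> (M *v x))"
    by (intro continuous_intros bounded_linear.continuous_on
        [OF matrix_vector_mul_bounded_linear])
  moreover have "norm (axis undefined 1 :: real^'n) = 1"
    by (simp add: norm_axis_1)
  ultimately obtain v where v: "norm v = 1"
    and max: "\<And>x. norm x = 1 \<Longrightarrow> x \<bullet> (M *v x) \<le> v \<bullet> (M *v v)"
    using continuous_attains_sup [of "sphere 0 1" "\<lambda>x. x \<bullet> (M *v x)"]
    by (metis (no_types, lifting) compact_sphere empty_iff mem_sphere_0)
  define c where "c = v \<bullet> (M *v v)"
  have le: "x \<bullet> (M *v x) \<le> c * (x \<bullet> x)" for x
  proof (cases "x = 0")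
    case False
    define u where "u = x /\<^sub>R norm x"
    have "x = norm x *\<^sub>R u" "norm u = 1"
      using False by (simp_all add: u_def)
    then have "x \<bullet> (M *v x) = (norm x)\<^sup>2 * (u \<bullet> (M *v u))"
      by (metis (no_types, lifting) inner_scaleR_left inner_scaleR_right mult.assoc
          matrix_vector_mult_bilinear(8) power2_eq_square)
    also have "\<dots> \<le> (norm x)\<^sup>2 * c"
      using max [OF \<open>norm u = 1\<close>] by (intro mult_left_mono) (auto simp: c_def)
    finally show ?thesis
      by (simp add: power2_norm_eq_inner mult.commute)
  qed simp
  have "c *\<^sub>R mat 1 - M \<in> psd_mats"
    using assms le
    by (auto simp: psd_mats_def sym_mats_def transpose_linear matrix_vector_mult_bilinear
        inner_diff_right)
  moreover have "v \<bullet> ((c *\<^sub>R mat 1 - M) *v v) = 0"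
    using v by (simp add: matrix_vector_mult_bilinear inner_diff_right c_def norm_eq_1)
  ultimately have "(c *\<^sub>R mat 1 - M) *v v = 0"
    by (rule psd_mats_null)
  then have "M *v v = c *\<^sub>R v"
    by (simp add: matrix_vector_mult_bilinear)
  with v le show ?thesis
    unfolding c_def by (rule that)
qed

lemma rayleigh_min_eigenvector:
  fixes M :: "real^'n^'n"
  assumes "M \<in> sym_mats"
  obtains v where "norm v = 1" "\<And>x. (v \<bullet> (M *v v)) * (x \<bullet> x) \<le> x \<bullet> (M *v x)"
    "M *v v = (v \<bullet> (M *v v)) *\<^sub>R v"
proof -
  have "- M \<in> sym_mats"
    using assms subspace_neg [OF subspace_sym_mats] by blast
  then obtain v where "norm v = 1" "\<And>x. x \<bullet> (- M *v x) \<le> (v \<bullet> (- M *v v)) * (x \<bullet> x)"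
    "- M *v v = (v \<bullet> (- M *v v)) *\<^sub>R v"
    using rayleigh_max_eigenvector by metis
  then show ?thesis
    by (intro that) (auto simp: matrix_vector_mult_bilinear)
qed

lemma indefinite_eigenvalues:
  assumes "indefinite M"
  shows "\<exists>c. eigenvalue M c \<and> 0 < c" "\<exists>c. eigenvalue M c \<and> c < 0"
proof -
  from assms obtain x y where sym: "M \<in> sym_mats" and x: "0 < x \<bullet> (M *v x)"
    and y: "y \<bullet> (M *v y) < 0"
    by (auto simp: indefinite_def)
  obtain v where v: "norm v = 1" "\<And>x. x \<bullet> (M *v x) \<le> (v \<bullet> (M *v v)) * (x \<bullet> x)"
    "M *v v = (v \<bullet> (M *v v)) *\<^sub>R v"
    using rayleigh_max_eigenvector [OF sym] by metis
  have "0 < (v \<bullet> (M *v v)) * (x \<bullet> x)"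
    using x v(2) [of x] by linarith
  then have "0 < v \<bullet> (M *v v)"
    by (metis inner_ge_zero less_le_not_le zero_less_mult_iff)
  then show "\<exists>c. eigenvalue M c \<and> 0 < c"
    using v(1,3) unfolding eigenvalue_def by (metis norm_zero zero_neq_one)
  obtain w where w: "norm w = 1" "\<And>x. (w \<bullet> (M *v w)) * (x \<bullet> x) \<le> x \<bullet> (M *v x)"
    "M *v w = (w \<bullet> (M *v w)) *\<^sub>R w"
    using rayleigh_min_eigenvector [OF sym] by metis
  have "(w \<bullet> (M *v w)) * (y \<bullet> y) < 0"
    using y w(2) [of y] by linarith
  then have "w \<bullet> (M *v w) < 0"
    by (metis inner_ge_zero less_le_not_le mult_less_0_iff)
  then show "\<exists>c. eigenvalue M c \<and> c < 0"
    using w(1,3) unfolding eigenvalue_def by (metis norm_zero zero_neq_one)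
qed

text \<open>The form of \<open>Q\<close> is at least \<mu> times the squared norm, that of
  \<open>M\<close> at least \<open>- c\<close> times it, so any \<open>s\<close> with
  \<open>s * c \<le> \<mu>\<close> will do. This is the room in which a positive definite solution
  can be moved.\<close>

lemma pos_def_perturb:
  assumes Q: "pos_def Q" and M: "M \<in> sym_mats"
  obtains s where "0 < s" "Q + s *\<^sub>R M \<in> psd_mats"
proof -
  have symQ: "Q \<in> sym_mats"
    using Q by (simp add: pos_def_def)
  obtain v where v: "norm v = 1" "\<And>x. (v \<bullet> (Q *v v)) * (x \<bullet> x) \<le> x \<bullet> (Q *v x)"
    using rayleigh_min_eigenvector [OF symQ] by metis
  obtain w where w: "\<And>x. (w \<bullet> (M *v w)) * (x \<bullet> x) \<le> x \<bullet> (M *v x)"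
    using rayleigh_min_eigenvector [OF M] by metis
  define \<mu> c where "\<mu> = v \<bullet> (Q *v v)" and "c = \<bar>w \<bullet> (M *v w)\<bar>"
  have "v \<noteq> 0"
    using v(1) by auto
  then have "0 < \<mu>"
    using Q by (simp add: pos_def_def \<mu>_def)
  define s where "s = \<mu> / (c + 1)"
  have "0 \<le> c"
    by (simp add: c_def)
  have "0 < s" and sc: "s * c \<le> \<mu>"
    using \<open>0 < \<mu>\<close> \<open>0 \<le> c\<close> by (simp_all add: s_def field_simps)
  have "0 \<le> x \<bullet> ((Q + s *\<^sub>R M) *v x)" for x
  proof -
    have "- c * (x \<bullet> x) \<le> (w \<bullet> (M *v w)) * (x \<bullet> x)"
      by (intro mult_right_mono) (auto simp: c_def)
    also have "\<dots> \<le> x \<bullet> (M *v x)"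
      by (rule w)
    finally have "s * (- c * (x \<bullet> x)) \<le> s * (x \<bullet> (M *v x))"
      using \<open>0 < s\<close> by (intro mult_left_mono) auto
    moreover have "s * c * (x \<bullet> x) \<le> \<mu> * (x \<bullet> x)"
      using sc by (intro mult_right_mono) auto
    moreover have "\<mu> * (x \<bullet> x) \<le> x \<bullet> (Q *v x)"
      using v(2) by (simp add: \<mu>_def)
    ultimately show ?thesis
      by (simp add: matrix_vector_mult_bilinear inner_add_right algebra_simps)
  qed
  then have "Q + s *\<^sub>R M \<in> psd_mats"
    using subspace_add [OF subspace_sym_mats symQ subspace_scale [OF subspace_sym_mats M]]
    by (simp add: psd_mats_def)
  with \<open>0 < s\<close> show ?thesis
    by (rule that)
qed

section \<open>Controllability and the Lyapunov operator\<close>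

text \<open>Turns the Kalman rank condition into an induction principle: the smallest
  \<open>A\<close>-invariant subspace containing the range of \<open>B\<close> is everything. It is
  applied to kernels, to vectors on which a matrix function is constant, and to an orthogonal
  complement.\<close>

lemma controllable_induct:
  fixes A :: "real^'n^'n" and B :: "real^'m^'n"
  assumes ctr: "controllable A B" and V: "subspace V"
    and B: "\<And>x. B *v x \<in> V" and A: "\<And>v. v \<in> V \<Longrightarrow> A *v v \<in> V"
  shows "v \<in> V"
proof -
  have "(((\<lambda>M. A ** M) ^^ k) B) *v x \<in> V" for k x
    by (induction k) (simp_all add: A B flip: matrix_vector_mul_assoc)
  then have "(\<Union>k < CARD('n). columns (((\<lambda>M. A ** M) ^^ k) B)) \<subseteq> V"
    by (auto simp: columns_image_basis)
  then have "span (\<Union>k < CARD('n). columns (((\<lambda>M. A ** M) ^^ k) B)) \<subseteq> V"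
    using V span_minimal by blast
  moreover have "span (\<Union>k < CARD('n). columns (((\<lambda>M. A ** M) ^^ k) B)) = UNIV"
    using ctr dim_eq_full [where 'a = "real^'n"] by (auto simp: controllable_def)
  ultimately show ?thesis
    by blast
qed

text \<open>The sign makes \<open>lyap A N\<close> the change of \<open>Q\<close> that compensates a
  constant shift of the Riccati solution by \<open>N\<close>.\<close>

definition lyap :: "real^'n^'n \<Rightarrow> real^'n^'n \<Rightarrow> real^'n^'n" where
  "lyap A P = - (transpose A ** P + P ** A)"

definition null_sym :: "real^'m^'n \<Rightarrow> (real^'n^'n) set" where
  "null_sym B = {P \<in> sym_mats. transpose B ** P = 0}"

lemma linear_lyap: "linear (lyap A)"
  by (intro linearI) (simp_all add: lyap_def matrix_mult_bilinear algebra_simps)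

lemma continuous_on_lyap: "continuous_on S (lyap A)"
  using linear_lyap linear_continuous_on linear_conv_bounded_linear by blast

lemma lyap_sym: "P \<in> sym_mats \<Longrightarrow> lyap A P \<in> sym_mats"
  by (simp add: lyap_def sym_mats_def transpose_linear matrix_transpose_mul add.commute)

lemma subspace_null_sym: "subspace (null_sym B)"
  using subspace_sym_mats by (auto simp: subspace_def null_sym_def matrix_mult_bilinear)

lemma difference_space_eq: "difference_space A B = lyap A ` null_sym B"
proof -
  have "transpose A ** P + P ** A + Q = 0 \<longleftrightarrow> Q = lyap A P" for P Q
    by (metis add_eq_0_iff lyap_def)
  then show ?thesis
    by (auto simp: difference_space_def null_sym_def)
qed

lemma null_sym_mult:
  assumes "P \<in> null_sym B"
  shows "P ** B = 0" "P *v (B *v x) = 0" "transpose B ** P = 0"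
proof -
  show *: "transpose B ** P = 0"
    using assms by (simp add: null_sym_def)
  have "transpose (transpose B ** P) = transpose P ** B"
    by (simp only: matrix_transpose_mul transpose_transpose)
  moreover have "transpose P = P"
    using assms by (simp add: null_sym_def sym_mats_def)
  ultimately show "P ** B = 0"
    by (simp add: * transpose_linear)
  then show "P *v (B *v x) = 0"
    by (simp add: matrix_vector_mul_assoc)
qed

(* If P v = 0 then v \<bullet> lyap A P v = 0, hence lyap A P v = 0, hence P (A v) = 0: the kernel of P is
   A-invariant. *)
lemma null_sym_lyap_psd:
  assumes "controllable A B" and P: "P \<in> null_sym B" and psd: "lyap A P \<in> psd_mats"
  shows "P = 0"
proof -
  have "P *v v = 0" for v
  proof -
    have "v \<in> {v. P *v v = 0}"
    proof (rule controllable_induct [OF assms(1)])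
      show "subspace {v. P *v v = 0}"
        by (auto simp: subspace_def matrix_vector_mult_bilinear)
      show "B *v x \<in> {v. P *v v = 0}" for x
        using null_sym_mult(2) [OF P] by simp
      fix v assume "v \<in> {v. P *v v = 0}"
      then have v: "P *v v = 0"
        by simp
      have L: "lyap A P *v v = - (P *v (A *v v))"
        by (simp add: lyap_def matrix_vector_mult_bilinear v del: transpose_matrix_vector
            flip: matrix_vector_mul_assoc)
      moreover have "v \<bullet> (P *v (A *v v)) = 0"
        using P sym_mats_inner_commute [of P v "A *v v"] v by (simp add: null_sym_def)
      ultimately have "lyap A P *v v = 0"
        using psd by (intro psd_mats_null) auto
      with L show "A *v v \<in> {v. P *v v = 0}"
        by simp
    qed
    then show ?thesis
      by simp
  qed
  then show ?thesis
    by (simp add: matrix_eq)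
qed

section \<open>The subspace of differences meets the psd cone only in zero\<close>

lemma subspace_difference_space: "subspace (difference_space A B)"
  by (simp add: difference_space_eq linear_subspace_image linear_lyap subspace_null_sym)

lemma difference_space_psd:
  assumes "controllable A B" "M \<in> difference_space A B" "M \<in> psd_mats"
  shows "M = 0"
  using assms null_sym_lyap_psd linear_0 [OF linear_lyap] by (fastforce simp: difference_space_eq)

lemma difference_space_indefinite:
  assumes "controllable A B" "M \<in> difference_space A B" "M \<noteq> 0"
  shows "indefinite M"
proof -
  have sym: "M \<in> sym_mats"
    using assms(2) lyap_sym by (auto simp: difference_space_eq null_sym_def)
  have "M \<notin> psd_mats" "- M \<notin> psd_mats"
    using assms difference_space_psd [of A B] subspace_neg [OF subspace_difference_space]
    by force+
  then show ?thesis
    using sym subspace_neg [OF subspace_sym_mats sym]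
    by (auto simp: indefinite_def psd_mats_def matrix_vector_mult_bilinear not_le)
qed

lemma inj_on_lyap: "controllable A B \<Longrightarrow> inj_on (lyap A) (null_sym B)"
  using linear_injective_on_subspace_0 [OF linear_lyap subspace_null_sym] null_sym_lyap_psd
    zero_in_psd_mats by metis

section \<open>The dimension of the difference space\<close>

definition dyad :: "real^'n \<Rightarrow> real^'m \<Rightarrow> real^'m^'n" where
  "dyad a b = (\<chi> i j. a $ i * b $ j)"

lemma dyad_mult_vec: "dyad a b *v x = (b \<bullet> x) *\<^sub>R a"
  by (simp add: dyad_def matrix_vector_mult_def vec_eq_iff inner_vec_def sum_distrib_left mult_ac)

lemma transpose_dyad: "transpose (dyad a b) = dyad b a"
  by (simp add: dyad_def transpose_def mult.commute)

lemma inner_dyad: "dyad a b \<bullet> dyad c d = (a \<bullet> c) * (b \<bullet> d)"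
  by (simp only: dyad_def inner_vec_def sum_product) (simp add: inner_vec_def mult_ac)

lemma dyad_add: "dyad (a + b) c = dyad a c + dyad b c" "dyad a (b + d) = dyad a b + dyad a d"
  by (simp_all add: dyad_def vec_eq_iff algebra_simps)

lemma dyad_psd: "dyad v v \<in> psd_mats"
  by (simp add: psd_mats_def sym_mats_def transpose_dyad dyad_mult_vec inner_commute)

lemma dyad_null_sym:
  assumes "v v* B = 0"
  shows "dyad v v \<in> null_sym B"
proof -
  have "(transpose B ** dyad v v) *v x = 0" for x
    by (simp add: dyad_mult_vec assms scaleR_vector_matrix_assoc flip: matrix_vector_mul_assoc)
  then have "transpose B ** dyad v v = 0"
    by (simp add: matrix_eq)
  then show ?thesis
    by (simp add: null_sym_def sym_mats_def transpose_dyad)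
qed

lemma null_sym_range:
  assumes "P \<in> null_sym B"
  shows "(P *v x) v* B = 0"
proof -
  have "transpose B *v (P *v x) = 0"
    using null_sym_mult(3) [OF assms]
    by (simp add: matrix_vector_mul_assoc del: transpose_matrix_vector)
  then show ?thesis
    by simp
qed

lemma subspace_left_kernel: "subspace {v. v v* B = (0 :: real^'m)}"
  by (auto simp: subspace_def vector_matrix_left_distrib scaleR_vector_matrix_assoc)

text \<open>The left kernel of \<open>B\<close> is the orthogonal complement of its range.\<close>

lemma dim_left_kernel:
  fixes B :: "real^'m^'n"
  shows "dim {v. v v* B = 0} = CARD('n) - rank B"
proof -
  have "v v* B = 0 \<longleftrightarrow> (\<forall>x. orthogonal (B *v x) v)" for v
    by (metis dot_lmul_matrix inner_commute inner_eq_zero_iff inner_zero_left orthogonal_def)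
  then have "{v. v v* B = 0} = {v \<in> UNIV. \<forall>x \<in> range ((*v) B). orthogonal x v}"
    by auto
  moreover have "dim {v \<in> UNIV. \<forall>x \<in> range ((*v) B). orthogonal x v} + dim (range ((*v) B))
      = dim (UNIV :: (real^'n) set)"
    by (rule dim_subspace_orthogonal_to_vectors) (auto intro!: linear_subspace_image)
  ultimately show ?thesis
    by (simp add: rank_dim_range)
qed

lemma left_kernel_orthonormal:
  fixes B :: "real^'m^'n"
  obtains e :: "nat \<Rightarrow> real^'n" where
    "\<And>i j. i < CARD('n) - rank B \<Longrightarrow> j < CARD('n) - rank B \<Longrightarrow> e i \<bullet> e j = (if i = j then 1 else 0)"
    "\<And>i. i < CARD('n) - rank B \<Longrightarrow> e i v* B = 0"
    "\<And>x. x v* B = 0 \<Longrightarrow> x = (\<Sum>i<CARD('n) - rank B. (e i \<bullet> x) *\<^sub>R e i)"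
proof -
  define k where "k = CARD('n) - rank B"
  define E where "E = {v. v v* B = 0}"
  obtain b where b: "b \<subseteq> E" "pairwise orthogonal b" "\<And>x. x \<in> b \<Longrightarrow> norm x = 1"
    "independent b" "card b = dim E" "span b = E"
    using orthonormal_basis_subspace [of E] subspace_left_kernel unfolding E_def by metis
  have "finite b"
    using b(4) by (rule independent_imp_finite)
  then obtain e where e: "bij_betw e {..<k} b"
    using b(5) ex_bij_betw_nat_finite [of b] by (auto simp: E_def dim_left_kernel k_def lessThan_atLeast0)
  have orth: "e i \<bullet> e j = (if i = j then 1 else 0)" if "i < k" "j < k" for i j
  proof (cases "i = j")
    case True
    then show ?thesis
      using b(3) e that by (auto simp: bij_betw_def norm_eq_1)
  next
    case False
    then have "e i \<noteq> e j"
      using e that by (auto simp: bij_betw_def inj_on_def)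
    then show ?thesis
      using b(2) e that False by (auto simp: bij_betw_def pairwise_def orthogonal_def)
  qed
  moreover have "e i v* B = 0" if "i < k" for i
    using b(1) e that by (auto simp: bij_betw_def E_def)
  moreover have "x = (\<Sum>i<k. (e i \<bullet> x) *\<^sub>R e i)" if "x v* B = 0" for x
  proof -
    have "x = (\<Sum>v\<in>b. (x \<bullet> v) *\<^sub>R v)"
      using orthonormal_basis_expand [OF b(2,3) _ \<open>finite b\<close>] that b(6) by (simp add: E_def)
    also have "\<dots> = (\<Sum>i<k. (e i \<bullet> x) *\<^sub>R e i)"
      using e by (intro sum.reindex_cong [of e]) (auto simp: bij_betw_def inner_commute)
    finally show ?thesis .
  qed
  ultimately show ?thesis
    unfolding k_def by (rule that)
qed

text \<open>Both claims rest on one family, the symmetrized dyads of an orthonormal basis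
  \<open>e\<close> of the left kernel of \<open>B\<close>. Polarization places it in the span of the
  squares \<open>dyad w w\<close>, expanding a matrix in \<open>e\<close> shows that it spans, and
  orthogonality permits counting it.\<close>

lemma null_sym_structure:
  fixes B :: "real^'m^'n"
  shows null_sym_eq_span_dyads: "null_sym B = span {dyad w w |w. w v* B = 0}"
    and dim_null_sym:
      "dim (null_sym B) = (CARD('n) - rank B) * (CARD('n) - rank B + 1) div 2"
proof -
  define k where "k = CARD('n) - rank B"
  obtain e :: "nat \<Rightarrow> real^'n" where
    orth: "\<And>i j. i < k \<Longrightarrow> j < k \<Longrightarrow> e i \<bullet> e j = (if i = j then 1 else 0)"
    and ker: "\<And>i. i < k \<Longrightarrow> e i v* B = 0"
    and expand: "\<And>x. x v* B = 0 \<Longrightarrow> x = (\<Sum>i<k. (e i \<bullet> x) *\<^sub>R e i)"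
    by (rule left_kernel_orthonormal [of B, folded k_def]) blast
  define G where "G = (\<lambda>(j, i). dyad (e i) (e j) + dyad (e j) (e i))"
  \<comment> \<open>Only pairs with \<open>i \<le> j\<close>, so that each symmetrized dyad is
    listed once.\<close>
  define J where "J = (SIGMA j:{..<k}. {..j})"
  define D where "D = {dyad w w |w. w v* B = 0}"
  have "D \<subseteq> null_sym B"
    by (auto simp: D_def dyad_null_sym)
  then have D: "span D \<subseteq> null_sym B"
    by (intro span_minimal subspace_null_sym)
  have GD: "G ` J \<subseteq> span D"
  proof clarify
    fix j i assume "(j, i) \<in> J"
    then have ij: "i < k" "j < k"
      by (auto simp: J_def)
    have "G (j, i) = dyad (e i + e j) (e i + e j) - dyad (e i) (e i) - dyad (e j) (e j)"
      by (simp add: G_def dyad_add)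
    moreover have "dyad (e i + e j) (e i + e j) \<in> D" "dyad (e i) (e i) \<in> D" "dyad (e j) (e j) \<in> D"
      using ij ker by (auto simp: D_def vector_matrix_left_distrib)
    ultimately show "G (j, i) \<in> span D"
      by (simp add: span_base span_diff)
  qed
  have NG: "null_sym B \<subseteq> span (G ` J)"
  proof
    fix P assume P: "P \<in> null_sym B"
    define p where "p i j = e i \<bullet> (P *v e j)" for i j
    have p_sym: "p i j = p j i" for i j
      using P sym_mats_inner_commute [of P] by (auto simp: p_def null_sym_def)
    have PE: "P *v e j = (\<Sum>i<k. p i j *\<^sub>R e i)" for j
      unfolding p_def by (rule expand) (rule null_sym_range [OF P])
    have P_eq: "P = (\<Sum>j<k. \<Sum>i<k. p i j *\<^sub>R dyad (e j) (e i))"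
    proof -
      have "P *v x = (\<Sum>j<k. \<Sum>i<k. p i j *\<^sub>R dyad (e j) (e i)) *v x" for x
      proof -
        have "P *v x = (\<Sum>j<k. (e j \<bullet> (P *v x)) *\<^sub>R e j)"
          by (rule expand) (rule null_sym_range [OF P])
        also have "\<dots> = (\<Sum>j<k. (\<Sum>i<k. p i j * (e i \<bullet> x)) *\<^sub>R e j)"
        proof (rule sum.cong [OF refl])
          fix j
          have "e j \<bullet> (P *v x) = x \<bullet> (P *v e j)"
            using P sym_mats_inner_commute by (auto simp: null_sym_def)
          also have "\<dots> = (\<Sum>i<k. p i j * (e i \<bullet> x))"
            by (simp add: PE inner_sum_right inner_commute)
          finally show "(e j \<bullet> (P *v x)) *\<^sub>R e j = (\<Sum>i<k. p i j * (e i \<bullet> x)) *\<^sub>R e j"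
            by simp
        qed
        also have "(\<Sum>j<k. (\<Sum>i<k. p i j * (e i \<bullet> x)) *\<^sub>R e j) =
            (\<Sum>j<k. \<Sum>i<k. p i j *\<^sub>R dyad (e j) (e i)) *v x"
          by (simp add: bounded_bilinear.sum_left [OF bounded_bilinear_matrix_vector_mult]
              matrix_vector_mult_bilinear dyad_mult_vec scaleR_sum_left)
        finally show ?thesis .
      qed
      then show ?thesis
        by (simp add: matrix_eq)
    qed
    \<comment> \<open>Symmetry of the coefficients allows the two indices to be exchanged; adding
      both expansions leaves only symmetrized dyads.\<close>
    have "P = (\<Sum>j<k. \<Sum>i<k. p i j *\<^sub>R dyad (e i) (e j))"
      by (subst P_eq, subst sum.swap) (simp add: p_sym)
    with P_eq have "P + P = (\<Sum>j<k. \<Sum>i<k. p i j *\<^sub>R dyad (e j) (e i)) +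
        (\<Sum>j<k. \<Sum>i<k. p i j *\<^sub>R dyad (e i) (e j))"
      by simp
    also have "\<dots> = (\<Sum>j<k. \<Sum>i<k. p i j *\<^sub>R (dyad (e j) (e i) + dyad (e i) (e j)))"
      by (simp add: scaleR_add_right sum.distrib)
    also have "\<dots> \<in> span (G ` J)"
    proof (intro span_sum span_scale)
      fix j i assume "j \<in> {..<k}" "i \<in> {..<k}"
      then have "(j, i) \<in> J \<or> (i, j) \<in> J"
        by (auto simp: J_def)
      then show "dyad (e j) (e i) + dyad (e i) (e j) \<in> span (G ` J)"
        by (force intro: span_base simp: G_def add.commute)
    qed
    finally have "(1/2) *\<^sub>R (P + P) \<in> span (G ` J)"
      by (rule span_scale)
    then show "P \<in> span (G ` J)"
      by (simp flip: scaleR_2)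
  qed
  have "span (G ` J) \<subseteq> span D"
    using GD by (rule span_minimal) (rule subspace_span)
  then have span: "span D = null_sym B" "span (G ` J) = null_sym B"
    using D NG by blast+
  then show "null_sym B = span {dyad w w |w. w v* B = 0}"
    by (simp add: D_def)
  \<comment> \<open>Distinct pairs give orthogonal matrices, while the squared norm is 2 off the
    diagonal and 4 on it; hence injectivity and independence together.\<close>
  have G_inner: "G p \<bullet> G q = (if p = q then G p \<bullet> G p else 0)" if "p \<in> J" "q \<in> J" for p q
    using that by (auto simp: G_def J_def inner_add_left inner_add_right inner_dyad orth split: if_splits)
  have G_pos: "G p \<noteq> 0" if "p \<in> J" for p
  proof -
    have "0 < G p \<bullet> G p"
      using that by (auto simp: G_def J_def inner_add_left inner_add_right inner_dyad orth
          simp del: inner_gt_zero_iff)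
    then show ?thesis
      by auto
  qed
  have inj: "inj_on G J"
  proof (rule inj_onI, rule ccontr)
    fix p q assume "p \<in> J" "q \<in> J" "G p = G q" "p \<noteq> q"
    then have "G p \<bullet> G p = 0"
      using G_inner [of p q] by simp
    then show False
      using G_pos \<open>p \<in> J\<close> by simp
  qed
  have "pairwise orthogonal (G ` J)"
  proof (rule pairwiseI)
    fix x y assume "x \<in> G ` J" "y \<in> G ` J" and ne: "x \<noteq> y"
    then obtain p q where pq: "p \<in> J" "q \<in> J" "x = G p" "y = G q"
      by blast
    have "p \<noteq> q"
      using ne pq(3,4) by blast
    with G_inner [OF pq(1,2)] have "G p \<bullet> G q = 0"
      by (simp only: if_False)
    then show "orthogonal x y"
      by (simp only: orthogonal_def pq(3,4))
  qed
  moreover have "0 \<notin> G ` J"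
    using G_pos by force
  ultimately have "independent (G ` J)"
    by (rule pairwise_orthogonal_independent)
  then have "dim (null_sym B) = card (G ` J)"
    by (metis span(2) dim_span_eq_card_independent)
  also have "\<dots> = (\<Sum>j<k. Suc j)"
    unfolding card_image [OF inj] by (simp add: J_def)
  also have "\<dots> = k * (k + 1) div 2"
    by (induction k) auto
  finally show "dim (null_sym B) = (CARD('n) - rank B) * (CARD('n) - rank B + 1) div 2"
    by (simp add: k_def)
qed

lemma dim_difference_space:
  fixes B :: "real^'m^'n"
  assumes "controllable A B"
  shows "dim (difference_space A B) = (CARD('n) - rank B) * (CARD('n) - rank B + 1) div 2"
  using dim_image_eq [of "lyap A" "null_sym B"] inj_on_lyap [OF assms] linear_lyap [of A]
    subspace_null_sym [of B] dim_null_sym [of B]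
  by (metis difference_space_eq span_eq_iff)

section \<open>Riccati equations with the same feedback\<close>

text \<open>The bound makes the derivative of \<open>exp (2 * c * s) * (D s \<bullet> D s)\<close>
  nonnegative. This nonnegative function is therefore at most its terminal value, which is
  0.\<close>

lemma terminal_gronwall_zero:
  fixes D :: "real \<Rightarrow> 'a :: real_inner"
  assumes deriv: "\<And>t. t \<in> {0..T} \<Longrightarrow> (D has_vector_derivative D' t) (at t within {0..T})"
    and bound: "\<And>t. t \<in> {0..T} \<Longrightarrow> norm (D' t) \<le> c * norm (D t)"
    and "D T = 0" and t: "t \<in> {0..T}"
  shows "D t = 0"
proof (cases "t = T")
  case False
  then have "t < T"
    using t by auto
  define f where "f = (\<lambda>s. exp (2 * c * s) * (D s \<bullet> D s))"
  define f' where "f' s = exp (2 * c * s) * (2 * c * (D s \<bullet> D s) + 2 * (D s \<bullet> D' s))" for s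
  have "\<exists>s\<in>{t<..<T}. f T - f t = (\<lambda>h. h * f' s) (T - t)"
  proof (rule mvt_simple [OF \<open>t < T\<close>])
    fix s assume "t \<le> s" "s \<le> T"
    then have "(D has_derivative (\<lambda>h. h *\<^sub>R D' s)) (at s within {t..T})"
      using t by (intro has_derivative_subset [OF deriv [unfolded has_vector_derivative_def]]) auto
    then show "(f has_derivative (\<lambda>h. h * f' s)) (at s within {t..T})"
      unfolding f_def f'_def
      by (auto intro!: derivative_eq_intros simp: inner_commute algebra_simps)
  qed
  then obtain s where s: "t < s" "s < T" "f T - f t = (T - t) * f' s"
    by auto
  then have "s \<in> {0..T}"
    using t by auto
  have "- (D s \<bullet> D' s) \<le> norm (D s) * norm (D' s)"
    using norm_cauchy_schwarz [of "D s" "- D' s"] by simp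
  also have "\<dots> \<le> norm (D s) * (c * norm (D s))"
    using bound [OF \<open>s \<in> {0..T}\<close>] by (intro mult_left_mono) auto
  also have "\<dots> = c * (D s \<bullet> D s)"
    by (simp add: dot_square_norm power2_eq_square)
  finally have "0 \<le> f' s"
    by (simp add: f'_def)
  then have "f t \<le> f T"
    using s(3) \<open>t < T\<close> by (smt (verit) mult_nonneg_nonneg)
  also have "f T = 0"
    using \<open>D T = 0\<close> by (simp add: f_def)
  finally have "exp (2 * c * t) * (D t \<bullet> D t) \<le> 0"
    by (simp add: f_def)
  then have "D t \<bullet> D t \<le> 0"
    unfolding not_less [symmetric] using mult_pos_pos [OF exp_gt_zero] by blast
  then show ?thesis
    using inner_gt_zero_iff not_less by blast
qed (use assms in simp)

lemma solves_DRE_deriv: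
  assumes "solves_DRE A B T Q F P" "t \<in> {0..T}"
  shows "(P has_vector_derivative
    - (P t ** A + transpose A ** P t - P t ** B ** transpose B ** P t + Q)) (at t within {0..T})"
  using assms by (simp add: solves_DRE_def)

lemma solves_DRE_continuous:
  assumes "solves_DRE A B T Q F P"
  shows "continuous_on {0..T} P"
  unfolding continuous_on_eq_continuous_within
  using solves_DRE_deriv [OF assms] has_vector_derivative_continuous by blast

text \<open>The skew part \<open>P t - transpose (P t)\<close> solves a homogeneous linear equation
  with zero terminal value, because \<open>Q\<close> and \<open>F\<close> are symmetric.\<close>

lemma solves_DRE_sym:
  fixes A :: "real^'n^'n"
  assumes sol: "solves_DRE A B T Q F P" and Q: "Q \<in> sym_mats" and F: "F \<in> sym_mats"
    and t: "t \<in> {0..T}"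
  shows "P t \<in> sym_mats"
proof -
  define S where "S = B ** transpose B"
  define D where "D t = P t - transpose (P t)" for t
  \<comment> \<open>These coefficients come from
    \<open>P S P - P\<^sup>T S P\<^sup>T = D S P\<^sup>T + P S D\<close>, which makes the equation
    for \<open>D\<close> formally linear. As \<open>P\<close> is continuous on a compact interval,
    they are bounded.\<close>
  define L R where "L t = A - S ** transpose (P t)" and "R t = transpose A - P t ** S" for t
  have tS: "transpose S = S"
    by (simp add: S_def matrix_transpose_mul)
  have deriv: "(D has_vector_derivative - (D t ** L t + R t ** D t)) (at t within {0..T})"
    if "t \<in> {0..T}" for t
  proof -
    let ?P' = "- (P t ** A + transpose A ** P t - P t ** S ** P t + Q)"
    have "(P has_vector_derivative ?P') (at t within {0..T})"
      using solves_DRE_deriv [OF sol that] by (simp add: S_def matrix_mul_assoc)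
    then have "(D has_vector_derivative ?P' - transpose ?P') (at t within {0..T})"
      unfolding D_def
      by (intro has_vector_derivative_diff
          bounded_linear.has_vector_derivative [OF bounded_linear_transpose])
    moreover have "?P' - transpose ?P' = - (D t ** L t + R t ** D t)"
      using Q by (simp add: sym_mats_def transpose_linear matrix_transpose_mul tS D_def L_def R_def
          matrix_mult_bilinear matrix_mul_assoc)
    ultimately show ?thesis
      by simp
  qed
  obtain k where k: "\<And>(X :: real^'n^'n) (Y :: real^'n^'n). norm (X ** Y) \<le> norm X * norm Y * k"
    using bounded_bilinear.bounded [OF bounded_bilinear_matrix_mult] by blast
  have cont: "continuous_on {0..T} (\<lambda>t. (norm (L t) + norm (R t)) * k)"
    unfolding L_def R_def using solves_DRE_continuous [OF sol]
    by (intro continuous_intros bounded_bilinear.continuous_on [OF bounded_bilinear_matrix_mult]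
        bounded_linear.continuous_on [OF bounded_linear_transpose])
  obtain c where c: "\<And>t. t \<in> {0..T} \<Longrightarrow> (norm (L t) + norm (R t)) * k \<le> c"
    using continuous_attains_sup [OF compact_Icc _ cont] t by (metis empty_iff)
  have "D t = 0"
  proof (rule terminal_gronwall_zero [OF deriv _ _ t])
    fix t assume t: "t \<in> {0..T}"
    have "norm (- (D t ** L t + R t ** D t)) \<le> norm (D t ** L t) + norm (R t ** D t)"
      using norm_triangle_ineq [of "D t ** L t" "R t ** D t"] by (simp only: norm_minus_cancel)
    also have "\<dots> \<le> norm (D t) * norm (L t) * k + norm (R t) * norm (D t) * k"
      by (intro add_mono k)
    also have "\<dots> = (norm (L t) + norm (R t)) * k * norm (D t)"
      by (simp add: algebra_simps)
    also have "\<dots> \<le> c * norm (D t)"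
      using c [OF t] by (intro mult_right_mono) auto
    finally show "norm (- (D t ** L t + R t ** D t)) \<le> c * norm (D t)" .
  next
    show "D T = 0"
      using sol F by (simp add: D_def solves_DRE_def sym_mats_def)
  qed
  then show ?thesis
    by (simp add: D_def sym_mats_def)
qed

(* Since B\<^sup>T (P1 - P2) = 0, the quadratic terms cancel, so D = P1 - P2 satisfies a linear equation.
   The vectors v for which D t v does not depend on t form an A-invariant subspace containing the
   range of B. *)
lemma solves_DRE_same_feedback:
  fixes A :: "real^'n^'n"
  assumes ctr: "controllable A B" and T: "0 < T"
    and sol1: "solves_DRE A B T Q1 F1 P1" and sol2: "solves_DRE A B T Q2 F2 P2"
    and sym: "Q1 \<in> sym_mats" "F1 \<in> sym_mats" "Q2 \<in> sym_mats" "F2 \<in> sym_mats"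
    and same: "\<And>t. t \<in> {0..T} \<Longrightarrow> transpose B ** P1 t = transpose B ** P2 t"
  shows "F1 - F2 \<in> null_sym B" "Q1 - Q2 = lyap A (F1 - F2)"
proof -
  define D where "D t = P1 t - P2 t" for t
  have sym1: "P1 t \<in> sym_mats" and sym2: "P2 t \<in> sym_mats" if "t \<in> {0..T}" for t
    using solves_DRE_sym [OF sol1 sym(1,2) that] solves_DRE_sym [OF sol2 sym(3,4) that] by auto
  have DN: "D t \<in> null_sym B" if "t \<in> {0..T}" for t
    using same [OF that] subspace_diff [OF subspace_sym_mats sym1 sym2, OF that that]
    by (simp add: null_sym_def D_def matrix_mult_bilinear)
  define N where "N = F1 - F2"
  have DT: "D T = N"
    using sol1 sol2 by (simp add: D_def N_def solves_DRE_def)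
  then have NN: "N \<in> null_sym B"
    using DN [of T] T by simp
  have deriv: "(D has_vector_derivative lyap A (D t) - (Q1 - Q2)) (at t within {0..T})"
    if t: "t \<in> {0..T}" for t
  proof -
    \<comment> \<open>With symmetric \<open>P1 t\<close> and \<open>P2 t\<close>, the transposed
      feedback identity says that the left factors \<open>P1 t ** B\<close> and
      \<open>P2 t ** B\<close> agree too.\<close>
    have "transpose (transpose B ** P1 t) = transpose (transpose B ** P2 t)"
      using same [OF t] by simp
    moreover have "transpose (P1 t) = P1 t" "transpose (P2 t) = P2 t"
      using sym1 [OF t] sym2 [OF t] by (simp_all add: sym_mats_def)
    ultimately have "P1 t ** B = P2 t ** B"
      by (simp add: matrix_transpose_mul)
    then have "P1 t ** B ** (transpose B ** P1 t) = P2 t ** B ** (transpose B ** P2 t)"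
      using same [OF t] by simp
    then have quad: "P1 t ** B ** transpose B ** P1 t = P2 t ** B ** transpose B ** P2 t"
      by (simp add: matrix_mul_assoc)
    have "(D has_vector_derivative
        - (P1 t ** A + transpose A ** P1 t - P1 t ** B ** transpose B ** P1 t + Q1) -
        - (P2 t ** A + transpose A ** P2 t - P2 t ** B ** transpose B ** P2 t + Q2))
        (at t within {0..T})"
      unfolding D_def
      by (intro has_vector_derivative_diff solves_DRE_deriv [OF sol1] solves_DRE_deriv [OF sol2] t)
    then show ?thesis
      by (simp add: quad D_def lyap_def matrix_mult_bilinear algebra_simps)
  qed
  have const: "D t *v v = N *v v" if t: "t \<in> {0..T}" for t v
  proof -
    have "v \<in> {v. \<forall>t\<in>{0..T}. D t *v v = N *v v}"
    proof (rule controllable_induct [OF ctr])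
      show "subspace {v. \<forall>t\<in>{0..T}. D t *v v = N *v v}"
        by (auto simp: subspace_def matrix_vector_mult_bilinear)
      show "B *v x \<in> {v. \<forall>t\<in>{0..T}. D t *v v = N *v v}" for x
        using null_sym_mult(2) [OF DN] null_sym_mult(2) [OF NN] by simp
      fix v assume "v \<in> {v. \<forall>t\<in>{0..T}. D t *v v = N *v v}"
      then have v: "D t *v v = N *v v" if "t \<in> {0..T}" for t
        using that by blast
      \<comment> \<open>Since \<open>D t *v v\<close> is constant in \<open>t\<close>, its
        derivative vanishes, and the differential equation then expresses
        \<open>D t *v (A *v v)\<close> by quantities independent of \<open>t\<close>.\<close>
      have Av: "D t *v (A *v v) = - (transpose A *v (N *v v) + (Q1 - Q2) *v v)" if t: "t \<in> {0..T}" for t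
      proof -
        have "((\<lambda>t. D t *v v) has_vector_derivative (lyap A (D t) - (Q1 - Q2)) *v v)
            (at t within {0..T})"
          by (rule bounded_linear.has_vector_derivative [OF
                bounded_bilinear.bounded_linear_left [OF bounded_bilinear_matrix_vector_mult]
                deriv [OF t]])
        moreover have "((\<lambda>t. D t *v v) has_vector_derivative 0) (at t within {0..T})"
          by (rule has_vector_derivative_transform [OF t v has_vector_derivative_const])
        ultimately have "(lyap A (D t) - (Q1 - Q2)) *v v = 0"
          using vector_derivative_unique_within_closed_interval [of 0 T t] T t by auto
        then have "D t *v (A *v v) = - (transpose A *v (D t *v v) + (Q1 - Q2) *v v)"
          by (simp add: lyap_def matrix_vector_mult_bilinear algebra_simps
              matrix_vector_mul_assoc del: transpose_matrix_vector)
        then show ?thesis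
          by (simp add: v [OF t])
      qed
      have "D t *v (A *v v) = N *v (A *v v)" if "t \<in> {0..T}" for t
        using Av [OF that] Av [of T] T by (simp add: DT)
      then show "A *v v \<in> {v. \<forall>t\<in>{0..T}. D t *v v = N *v v}"
        by blast
    qed
    then show ?thesis
      using t by blast
  qed
  then have "D t = N" if "t \<in> {0..T}" for t
    using that by (simp add: matrix_eq)
  \<comment> \<open>Comparing this with the differential equation at \<open>T\<close> reads off
    \<open>Q1 - Q2\<close>.\<close>
  then have "(D has_vector_derivative 0) (at T within {0..T})"
    using T by (intro has_vector_derivative_transform [OF _ _ has_vector_derivative_const]) auto
  moreover have "(D has_vector_derivative lyap A N - (Q1 - Q2)) (at T within {0..T})"
    using deriv [of T] T by (simp add: DT)
  ultimately have "lyap A N - (Q1 - Q2) = 0"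
    using vector_derivative_unique_within_closed_interval [of 0 T T D] T by force
  then show "Q1 - Q2 = lyap A (F1 - F2)"
    by (simp add: N_def)
  show "F1 - F2 \<in> null_sym B"
    using NN by (simp add: N_def)
qed

text \<open>The constant \<open>N\<close> is annihilated by \<open>B\<close> from either side, so
  the quadratic term stays as it is, and \<open>lyap A N\<close> absorbs the change of the linear
  terms.\<close>

lemma solves_DRE_shift:
  assumes sol: "solves_DRE A B T Q F P" and N: "N \<in> null_sym B"
  shows "solves_DRE A B T (Q + lyap A N) (F + N) (\<lambda>t. P t + N)"
proof -
  have "((\<lambda>t. P t + N) has_vector_derivative
      - ((P t + N) ** A + transpose A ** (P t + N) - (P t + N) ** B ** transpose B ** (P t + N) +
         (Q + lyap A N))) (at t within {0..T})" if "t \<in> {0..T}" for t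
  proof -
    have "(P t + N) ** B ** (transpose B ** (P t + N)) = P t ** B ** (transpose B ** P t)"
      by (simp add: null_sym_mult(1,3) [OF N] matrix_mult_bilinear)
    then have "(P t + N) ** B ** transpose B ** (P t + N) = P t ** B ** transpose B ** P t"
      by (simp add: matrix_mul_assoc)
    moreover have "((\<lambda>t. P t + N) has_vector_derivative
        - (P t ** A + transpose A ** P t - P t ** B ** transpose B ** P t + Q) + 0)
        (at t within {0..T})"
      by (intro has_vector_derivative_add has_vector_derivative_const solves_DRE_deriv [OF sol that])
    moreover have "- ((P t + N) ** A + transpose A ** (P t + N) - Z + (Q + lyap A N)) =
        - (P t ** A + transpose A ** P t - Z + Q) + 0" for Z
      by (simp add: lyap_def matrix_mult_bilinear)
    ultimately show ?thesis
      by (simp only:)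
  qed
  then show ?thesis
    using sol by (simp add: solves_DRE_def)
qed

text \<open>Any feasible pair \<open>(Q, F)\<close> can serve as base point. The uniqueness argument
  supplies \<open>N = F' - F\<close> for another feasible pair, and \<open>solves_DRE_shift\<close>
  supplies the converse.\<close>

lemma solution_space_eq:
  fixes A :: "real^'n^'n"
  assumes ctr: "controllable A B" and T: "0 < T" and Q: "Q \<in> psd_mats" and F: "F \<in> psd_mats"
    and K: "is_DRE A B T Q F K"
  shows "solution_space A B T K =
    (\<lambda>N. Q + lyap A N) ` {N \<in> null_sym B. Q + lyap A N \<in> psd_mats \<and> F + N \<in> psd_mats}"
proof (intro equalityI subsetI)
  obtain P where P: "solves_DRE A B T Q F P" "\<And>t. t \<in> {0..T} \<Longrightarrow> K t = - (transpose B ** P t)"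
    using K by (auto simp: is_DRE_def)
  {
    fix Q' assume "Q' \<in> solution_space A B T K"
    then obtain F' P' where *: "Q' \<in> psd_mats" "F' \<in> psd_mats" "solves_DRE A B T Q' F' P'"
      "\<And>t. t \<in> {0..T} \<Longrightarrow> K t = - (transpose B ** P' t)"
      by (auto simp: solution_space_def is_DRE_def)
    have "transpose B ** P' t = transpose B ** P t" if "t \<in> {0..T}" for t
      using P(2) [OF that] *(4) [OF that] by (metis neg_equal_iff_equal)
    note F' = solves_DRE_same_feedback [OF ctr T *(3) P(1) _ _ _ _ this]
    have "F' - F \<in> null_sym B" "Q' - Q = lyap A (F' - F)"
      using F' *(1,2) Q F by (auto simp: psd_mats_sym)
    then show "Q' \<in> (\<lambda>N. Q + lyap A N) ` {N \<in> null_sym B. Q + lyap A N \<in> psd_mats \<and> F + N \<in> psd_mats}"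
      using *(1,2) by (intro image_eqI [of _ _ "F' - F"]) (auto simp flip: \<open>Q' - Q = _\<close>)
  next
    fix Q' assume "Q' \<in> (\<lambda>N. Q + lyap A N) ` {N \<in> null_sym B. Q + lyap A N \<in> psd_mats \<and> F + N \<in> psd_mats}"
    then obtain N where N: "N \<in> null_sym B" "Q' = Q + lyap A N" "Q' \<in> psd_mats" "F + N \<in> psd_mats"
      by auto
    have "K t = - (transpose B ** (P t + N))" if "t \<in> {0..T}" for t
      using P(2) [OF that] by (simp add: matrix_mult_bilinear null_sym_mult(3) [OF N(1)])
    then have "is_DRE A B T Q' (F + N) K"
      using solves_DRE_shift [OF P(1) N(1)] by (auto simp: is_DRE_def N(2))
    with N show "Q' \<in> solution_space A B T K"
      by (auto simp: solution_space_def)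
  }
qed

section \<open>Geometry of the solution space\<close>

lemma solution_space_diff:
  assumes "controllable A B" "0 < T" "Q \<in> solution_space A B T K" "Q' \<in> solution_space A B T K"
  shows "Q' - Q \<in> difference_space A B"
proof -
  obtain F where "Q \<in> psd_mats" "F \<in> psd_mats" "is_DRE A B T Q F K"
    using assms(3) by (auto simp: solution_space_def)
  from solution_space_eq [OF assms(1,2) this] assms(4) show ?thesis
    by (auto simp: difference_space_eq)
qed

(* For N on the unit sphere of null_sym B, lyap A N has positive distance \<delta> to the closed cone
   psd_mats, so Q + lyap A N can be positive semidefinite only if \<delta> * norm N \<le> norm Q. *)
lemma bounded_lyap_psd:
  fixes A :: "real^'n^'n"
  assumes "controllable A B"
  shows "bounded {N \<in> null_sym B. Q + lyap A N \<in> psd_mats}"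
proof -
  define U where "U = null_sym B \<inter> sphere 0 1"
  have "compact U"
    unfolding U_def by (intro closed_Int_compact closed_subspace subspace_null_sym compact_sphere)
  then have "compact (lyap A ` U)"
    by (intro compact_continuous_image continuous_on_lyap)
  moreover have "lyap A ` U \<inter> psd_mats = {}"
    using null_sym_lyap_psd [OF assms] by (force simp: U_def)
  ultimately obtain \<delta> where \<delta>: "0 < \<delta>"
    "\<And>X Y. X \<in> lyap A ` U \<Longrightarrow> Y \<in> psd_mats \<Longrightarrow> \<delta> \<le> dist X Y"
    using separate_compact_closed closed_psd_mats by metis
  have "norm N \<le> norm Q / \<delta>" if N: "N \<in> null_sym B" "Q + lyap A N \<in> psd_mats" for N
  proof (cases "N = 0")
    case False
    define c where "c = inverse (norm N)"
    have "0 < c"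
      using False by (simp add: c_def)
    have "c *\<^sub>R N \<in> U"
      using False N(1) subspace_scale [OF subspace_null_sym] by (auto simp: U_def c_def)
    moreover have "c *\<^sub>R (Q + lyap A N) \<in> psd_mats"
      using N(2) \<open>0 < c\<close> by (intro psd_mats_scaleR) auto
    ultimately have "\<delta> \<le> dist (lyap A (c *\<^sub>R N)) (c *\<^sub>R (Q + lyap A N))"
      by (intro \<delta>(2)) auto
    also have "\<dots> = c * norm Q"
      using \<open>0 < c\<close> by (simp add: linear_cmul [OF linear_lyap] dist_norm algebra_simps)
    finally show ?thesis
      using False \<delta>(1) by (simp add: c_def field_simps)
  qed (use \<delta>(1) in simp)
  then show ?thesis
    unfolding bounded_iff by blast
qed

text \<open>Compactness is established for the parameter set \<open>C\<close>, where both psd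
  conditions are closed and \<open>bounded_lyap_psd\<close> applies, and is then transported by a
  continuous affine map. Working with \<open>C\<close> matters because a linear image of a closed
  set need not be closed.\<close>

lemma solution_space_topology:
  fixes A :: "real^'n^'n"
  assumes ctr: "controllable A B" and T: "0 < T" and Q: "Q \<in> psd_mats" and F: "F \<in> psd_mats"
    and K: "is_DRE A B T Q F K"
  shows "compact (solution_space A B T K)" "convex (solution_space A B T K)"
proof -
  define C where "C = {N \<in> null_sym B. Q + lyap A N \<in> psd_mats \<and> F + N \<in> psd_mats}"
  have D: "solution_space A B T K = (\<lambda>N. Q + lyap A N) ` C"
    unfolding C_def by (rule solution_space_eq [OF assms])
  have aff: "Q + lyap A (u *\<^sub>R M + v *\<^sub>R N) = u *\<^sub>R (Q + lyap A M) + v *\<^sub>R (Q + lyap A N)"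
    "F + (u *\<^sub>R M + v *\<^sub>R N) = u *\<^sub>R (F + M) + v *\<^sub>R (F + N)"
    if "u + v = 1" for u v :: real and M N
  proof -
    have "X = u *\<^sub>R X + v *\<^sub>R X" for X :: "real^'n^'n"
      by (simp add: that flip: scaleR_add_left)
    then show "Q + lyap A (u *\<^sub>R M + v *\<^sub>R N) = u *\<^sub>R (Q + lyap A M) + v *\<^sub>R (Q + lyap A N)"
      "F + (u *\<^sub>R M + v *\<^sub>R N) = u *\<^sub>R (F + M) + v *\<^sub>R (F + N)"
      by (simp_all add: linear_add [OF linear_lyap] linear_cmul [OF linear_lyap] scaleR_add_right
          add_ac)
  qed
  have "convex C"
    using subspace_imp_convex [OF subspace_null_sym, of B] convex_psd_mats
    unfolding convex_def C_def by (auto simp: aff)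
  have "closed {N. Q + lyap A N \<in> psd_mats}" "closed {N. F + N \<in> psd_mats}"
    using continuous_closed_vimage [OF closed_psd_mats, of "\<lambda>N. Q + lyap A N"]
      continuous_closed_vimage [OF closed_psd_mats, of "\<lambda>N. F + N"] continuous_on_lyap [of UNIV A]
    by (auto simp: vimage_def continuous_on_eq_continuous_at intro!: continuous_intros)
  then have "closed (null_sym B \<inter> {N. Q + lyap A N \<in> psd_mats} \<inter> {N. F + N \<in> psd_mats})"
    by (intro closed_Int closed_subspace [OF subspace_null_sym])
  moreover have "C = null_sym B \<inter> {N. Q + lyap A N \<in> psd_mats} \<inter> {N. F + N \<in> psd_mats}"
    by (auto simp: C_def)
  moreover have "bounded C"
    by (rule bounded_subset [OF bounded_lyap_psd [OF ctr, of Q]]) (auto simp: C_def)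
  ultimately have "compact C"
    by (simp add: compact_eq_bounded_closed)
  then show "compact (solution_space A B T K)"
    unfolding D by (intro compact_continuous_image continuous_intros continuous_on_lyap)
  show "convex (solution_space A B T K)"
    unfolding D
  proof (rule convexI)
    fix x y and u v :: real
    assume "x \<in> (\<lambda>N. Q + lyap A N) ` C" "y \<in> (\<lambda>N. Q + lyap A N) ` C" and uv: "0 \<le> u" "0 \<le> v" "u + v = 1"
    then obtain M N where "M \<in> C" "N \<in> C" "x = Q + lyap A M" "y = Q + lyap A N"
      by auto
    then show "u *\<^sub>R x + v *\<^sub>R y \<in> (\<lambda>N. Q + lyap A N) ` C"
      using convexD [OF \<open>convex C\<close> _ _ uv] aff(1) [OF uv(3)] by (metis image_eqI)
  qed
qed

lemma solution_space_dyad: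
  fixes A :: "real^'n^'n"
  assumes ctr: "controllable A B" and T: "0 < T" and Q: "Q \<in> solution_space A B T K" "pos_def Q"
    and w: "w v* B = 0"
  obtains s where "0 < s" "Q + s *\<^sub>R lyap A (dyad w w) \<in> solution_space A B T K"
proof -
  obtain F where F: "Q \<in> psd_mats" "F \<in> psd_mats" "is_DRE A B T Q F K"
    using Q(1) by (auto simp: solution_space_def)
  have N: "dyad w w \<in> null_sym B"
    using w by (rule dyad_null_sym)
  obtain s where s: "0 < s" "Q + s *\<^sub>R lyap A (dyad w w) \<in> psd_mats"
    using pos_def_perturb [OF Q(2) lyap_sym] N by (auto simp: null_sym_def)
  have "F + s *\<^sub>R dyad w w \<in> psd_mats"
    using s(1) F(2) by (intro psd_mats_add psd_mats_scaleR dyad_psd) auto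
  then have "Q + s *\<^sub>R lyap A (dyad w w) \<in> solution_space A B T K"
    unfolding solution_space_eq [OF ctr T F] using s subspace_scale [OF subspace_null_sym N, of s]
    by (intro image_eqI [of _ _ "s *\<^sub>R dyad w w"]) (simp_all add: linear_cmul [OF linear_lyap])
  with s(1) show ?thesis
    by (rule that)
qed

section \<open>Affine dimension and the number of solutions\<close>

lemma aff_dim_solution_space_le:
  assumes "controllable A B" "0 < T" "Q \<in> solution_space A B T K"
  shows "aff_dim (solution_space A B T K) \<le> int (dim (difference_space A B))"
proof -
  have "(+) (- Q) ` solution_space A B T K \<subseteq> difference_space A B"
    using solution_space_diff [OF assms] by auto
  then show ?thesis
    using dim_subset by (simp add: aff_dim_eq_dim [OF hull_inc [OF assms(3)]])
qed

text \<open>After translation by \<open>- Q\<close> the set contains a positive multiple of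
  \<open>lyap A (dyad w w)\<close> for every \<open>w\<close> in the left kernel of
  \<open>B\<close>, and these matrices span the difference space.\<close>

lemma aff_dim_solution_space_pos_def:
  assumes "controllable A B" "0 < T" and Q: "Q \<in> solution_space A B T K" "pos_def Q"
  shows "aff_dim (solution_space A B T K) = int (dim (difference_space A B))"
proof (rule antisym)
  let ?D = "(+) (- Q) ` solution_space A B T K"
  have "lyap A (dyad w w) \<in> span ?D" if w: "w v* B = 0" for w
  proof -
    obtain s where s: "0 < s" "Q + s *\<^sub>R lyap A (dyad w w) \<in> solution_space A B T K"
      using solution_space_dyad [OF assms w] .
    then have "s *\<^sub>R lyap A (dyad w w) \<in> ?D"
      by (intro image_eqI [OF _ s(2)]) simp
    then have "inverse s *\<^sub>R s *\<^sub>R lyap A (dyad w w) \<in> span ?D"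
      by (intro span_scale span_base)
    with s(1) show ?thesis
      by simp
  qed
  then have "lyap A ` {dyad w w |w. w v* B = 0} \<subseteq> span ?D"
    by auto
  then have "span (lyap A ` {dyad w w |w. w v* B = 0}) \<subseteq> span ?D"
    by (rule span_minimal) (rule subspace_span)
  then have "difference_space A B \<subseteq> span ?D"
    by (simp add: difference_space_eq null_sym_eq_span_dyads linear_span_image [OF linear_lyap])
  then have "dim (difference_space A B) \<le> dim ?D"
    by (metis dim_span dim_subset)
  then show "int (dim (difference_space A B)) \<le> aff_dim (solution_space A B T K)"
    by (simp add: aff_dim_eq_dim [OF hull_inc [OF Q(1)]])
qed (rule aff_dim_solution_space_le [OF assms(1-3)])

text \<open>Every other solution is psd and at the same time a difference from 0, hence 0
  itself.\<close>

lemma solution_space_zero: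
  assumes "controllable A B" "0 < T" "0 \<in> solution_space A B T K"
  shows "solution_space A B T K = {0}"
proof -
  have "Q = 0" if "Q \<in> solution_space A B T K" for Q
    using difference_space_psd [OF assms(1)] solution_space_diff [OF assms that] that
    by (simp add: solution_space_def)
  with assms(3) show ?thesis
    by blast
qed

lemma left_kernel_nonzero:
  fixes B :: "real^'m^'n"
  assumes "rank B < CARD('n)"
  obtains w where "w v* B = 0" "w \<noteq> 0"
proof -
  have "dim {v. v v* B = 0} \<noteq> 0"
    using assms by (simp add: dim_left_kernel)
  then show ?thesis
    using that by (auto simp: dim_eq_0)
qed

lemma lyap_dyad_nonzero:
  assumes "controllable A B" "w v* B = 0" "w \<noteq> 0"
  shows "lyap A (dyad w w) \<noteq> 0"
proof
  assume "lyap A (dyad w w) = 0"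
  then have "dyad w w = 0"
    using null_sym_lyap_psd [OF assms(1) dyad_null_sym [OF assms(2)]] zero_in_psd_mats by simp
  then have "dyad w w *v w = 0"
    by simp
  with assms(3) show False
    by (simp add: dyad_mult_vec)
qed

text \<open>A finite nonempty convex set is connected, hence a single point, but a step along a dyad
  produces a second one.\<close>

lemma infinite_solution_space:
  fixes B :: "real^'m^'n"
  assumes "controllable A B" "0 < T" and Q: "Q \<in> solution_space A B T K" "pos_def Q"
    and "rank B < CARD('n)"
  shows "infinite (solution_space A B T K)"
proof
  assume fin: "finite (solution_space A B T K)"
  obtain w where w: "w v* B = 0" "w \<noteq> 0"
    using left_kernel_nonzero [OF assms(5)] .
  obtain s where s: "0 < s" "Q + s *\<^sub>R lyap A (dyad w w) \<in> solution_space A B T K"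
    using solution_space_dyad [OF assms(1-4) w(1)] .
  obtain F where F: "Q \<in> psd_mats" "F \<in> psd_mats" "is_DRE A B T Q F K"
    using Q(1) by (auto simp: solution_space_def)
  have "connected (solution_space A B T K)"
    by (intro convex_connected solution_space_topology(2) [OF assms(1,2) F])
  with fin obtain a where "solution_space A B T K = {a}"
    using connected_finite_iff_sing Q(1) by blast
  with Q(1) s lyap_dyad_nonzero [OF assms(1) w] show False
    by auto
qed

section \<open>A positive definite solution\<close>

text \<open>The Frobenius inner product is a sum over columns, and \<open>M\<close> acts on each
  column separately.\<close>

lemma inner_matrix_mult_coercive:
  fixes M X :: "real^'n^'n"
  assumes "\<And>x. x \<bullet> x \<le> x \<bullet> (M *v x)"
  shows "X \<bullet> X \<le> X \<bullet> (M ** X)"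
proof -
  have row: "transpose (M ** X) $ j = M *v (transpose X $ j)" for j
    by (simp add: vec_eq_iff transpose_def matrix_matrix_mult_def matrix_vector_mult_def)
  have "X \<bullet> X = (\<Sum>j\<in>UNIV. (transpose X $ j) \<bullet> (transpose X $ j))"
    by (metis inner_transpose inner_vec_def)
  also have "\<dots> \<le> (\<Sum>j\<in>UNIV. (transpose X $ j) \<bullet> (transpose (M ** X) $ j))"
    unfolding row by (intro sum_mono assms)
  also have "\<dots> = X \<bullet> (M ** X)"
    by (metis inner_transpose inner_vec_def)
  finally show ?thesis .
qed

text \<open>Coercivity of \<open>M\<close> makes the operator \<Phi> injective, hence surjective in
  finite dimension. As \<Phi> commutes with transposition, injectivity also forces the preimage of a
  symmetric matrix to be symmetric.\<close>

lemma lyapunov_equation_solvable: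
  fixes M C :: "real^'n^'n"
  assumes M: "\<And>x. x \<bullet> x \<le> x \<bullet> (M *v x)" and C: "C \<in> sym_mats"
  obtains W where "W \<in> sym_mats" "M ** W + W ** transpose M = C"
proof -
  define \<Phi> where "\<Phi> X = M ** X + X ** transpose M" for X
  have lin: "linear \<Phi>"
    unfolding \<Phi>_def by (intro linearI) (simp_all add: matrix_mult_bilinear algebra_simps)
  have "X = 0" if "\<Phi> X = 0" for X
  proof -
    have "X \<bullet> (X ** transpose M) = transpose X \<bullet> (M ** transpose X)"
      by (metis inner_transpose matrix_transpose_mul transpose_transpose)
    moreover have "X \<bullet> X \<le> X \<bullet> (M ** X)" "transpose X \<bullet> transpose X \<le> transpose X \<bullet> (M ** transpose X)"
      using inner_matrix_mult_coercive [OF M] by auto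
    moreover have "X \<bullet> (M ** X) + X \<bullet> (X ** transpose M) = 0"
      using that by (simp add: \<Phi>_def flip: inner_add_right)
    ultimately have "X \<bullet> X \<le> 0"
      using inner_ge_zero [of "transpose X"] by linarith
    then show ?thesis
      using inner_gt_zero_iff not_less by blast
  qed
  then have inj: "inj \<Phi>"
    by (simp add: linear_injective_0 [OF lin])
  then have "surj \<Phi>"
    by (rule linear_injective_imp_surjective [OF lin]) simp
  then obtain W where W: "\<Phi> W = C"
    by (metis surjD)
  have "\<Phi> (transpose W) = transpose (\<Phi> W)"
    by (simp add: \<Phi>_def transpose_linear matrix_transpose_mul add.commute)
  also have "\<dots> = \<Phi> W"
    using C by (simp add: W sym_mats_def)
  finally have "W \<in> sym_mats"
    using inj by (simp add: sym_mats_def inj_eq)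
  then show ?thesis
    using W by (intro that) (simp_all add: \<Phi>_def)
qed

text \<open>Testing the equation on an eigenvector \<open>v\<close> for the least eigenvalue \<mu>
  gives \<open>2 * \<mu> * (v \<bullet> (M *v v)) = (v v* B) \<bullet> (v v* B)\<close>, so \<mu> is
  nonnegative. Controllability then excludes a kernel.\<close>

lemma lyapunov_solution_pos_def:
  fixes M :: "real^'n^'n" and B :: "real^'m^'n"
  assumes ctr: "controllable A B" and MA: "M = A + c *\<^sub>R mat 1"
    and M: "\<And>x. x \<bullet> x \<le> x \<bullet> (M *v x)"
    and W: "W \<in> sym_mats" "M ** W + W ** transpose M = B ** transpose B"
  shows "pos_def W"
proof -
  have W_apply: "M *v (W *v x) + W *v (x v* M) = B *v (x v* B)" for x
  proof -
    have "(M ** W + W ** transpose M) *v x = (B ** transpose B) *v x"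
      by (simp add: W)
    then show ?thesis
      by (simp add: matrix_vector_mult_bilinear flip: matrix_vector_mul_assoc)
  qed
  have B_inner: "x \<bullet> (B *v (x v* B)) = (x v* B) \<bullet> (x v* B)" for x
    by (simp add: dot_lmul_matrix)
  have M_inner: "x \<bullet> (W *v (x v* M)) = x \<bullet> (M *v (W *v x))" for x
    using sym_mats_inner_commute [OF W(1), of x "x v* M"] by (simp add: dot_lmul_matrix)
  obtain v where v: "norm v = 1" "\<And>x. (v \<bullet> (W *v v)) * (x \<bullet> x) \<le> x \<bullet> (W *v x)"
    "W *v v = (v \<bullet> (W *v v)) *\<^sub>R v"
    using rayleigh_min_eigenvector [OF W(1)] by metis
  define \<mu> where "\<mu> = v \<bullet> (W *v v)"
  have "M *v (W *v v) = \<mu> *\<^sub>R (M *v v)"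
    using v(3) by (metis \<mu>_def matrix_vector_mult_scaleR)
  then have "v \<bullet> (M *v (W *v v)) = \<mu> * (v \<bullet> (M *v v))"
    by simp
  moreover have "v \<bullet> (M *v (W *v v) + W *v (v v* M)) = (v v* B) \<bullet> (v v* B)"
    by (simp only: W_apply B_inner)
  ultimately have "2 * \<mu> * (v \<bullet> (M *v v)) = (v v* B) \<bullet> (v v* B)"
    by (simp add: inner_add_right M_inner)
  then have "0 \<le> \<mu> * (v \<bullet> (M *v v))"
    using inner_ge_zero [of "v v* B"] by linarith
  moreover have "1 \<le> v \<bullet> (M *v v)"
    using M [of v] v(1) by (simp add: norm_eq_1)
  ultimately have "0 \<le> \<mu>"
    by (simp add: zero_le_mult_iff)
  have psd: "W \<in> psd_mats"
  proof -
    have "0 \<le> x \<bullet> (W *v x)" for x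
      using v(2) [of x] \<open>0 \<le> \<mu>\<close> by (metis \<mu>_def inner_ge_zero mult_nonneg_nonneg order_trans)
    then show ?thesis
      using W(1) by (simp add: psd_mats_def)
  qed
  \<comment> \<open>The kernel of \<open>W\<close> is invariant under \<open>transpose A\<close> and
    contained in the left kernel of \<open>B\<close>, so its orthogonal complement is
    \<open>A\<close>-invariant, contains the range of \<open>B\<close>, and is the whole
    space.\<close>
  define Z where "Z = {x. W *v x = 0}"
  have Z: "x v* B = 0" "x v* A \<in> Z" if "x \<in> Z" for x
  proof -
    have Wx: "W *v x = 0"
      using that by (simp add: Z_def)
    have "x \<bullet> (M *v (W *v x) + W *v (x v* M)) = (x v* B) \<bullet> (x v* B)"
      by (simp only: W_apply B_inner)
    then show B: "x v* B = 0"
      by (simp add: inner_add_right M_inner Wx)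
    have "x v* M = x v* A + c *\<^sub>R x"
      unfolding MA by (metis (no_types) matrix_vector_mul_lid matrix_vector_mult_add_rdistrib
          matrix_vector_mult_bilinear(7) transpose_linear(1,4) transpose_mat transpose_matrix_vector)
    then have "W *v (x v* M) = W *v (x v* A)"
      by (simp add: matrix_vector_mult_bilinear Wx)
    then show "x v* A \<in> Z"
      using W_apply [of x] by (simp add: Z_def Wx B)
  qed
  have Z0: "x = 0" if "x \<in> Z" for x
  proof -
    have "x \<in> {v. \<forall>z\<in>Z. z \<bullet> v = 0}"
    proof (rule controllable_induct [OF ctr])
      show "subspace {v. \<forall>z\<in>Z. z \<bullet> v = 0}"
        by (auto simp: subspace_def inner_add_right)
      show "B *v y \<in> {v. \<forall>z\<in>Z. z \<bullet> v = 0}" for y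
        using Z(1) by (simp flip: dot_lmul_matrix)
      show "A *v y \<in> {v. \<forall>z\<in>Z. z \<bullet> v = 0}" if "y \<in> {v. \<forall>z\<in>Z. z \<bullet> v = 0}" for y
        using that Z(2) by (simp flip: dot_lmul_matrix)
    qed
    then show ?thesis
      using that by auto
  qed
  have "0 < x \<bullet> (W *v x)" if "x \<noteq> 0" for x
    using psd psd_mats_null [OF psd, of x] Z0 [of x] that
    by (force simp: psd_mats_def Z_def less_le)
  then show ?thesis
    using W(1) by (simp add: pos_def_def)
qed

lemma pos_def_inverse:
  fixes W :: "real^'n^'n"
  assumes "pos_def W"
  obtains P where "pos_def P" "P ** W = mat 1" "W ** P = mat 1"
proof -
  have "x = 0" if "W *v x = 0" for x
    using assms that by (force simp: pos_def_def)
  then obtain P where P: "P ** W = mat 1"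
    by (metis matrix_left_invertible_ker)
  then have WP: "W ** P = mat 1"
    by (simp add: matrix_left_right_inverse)
  have W: "transpose W = W"
    using assms by (simp add: pos_def_def sym_mats_def)
  have "transpose P ** W = mat 1"
    by (metis W WP matrix_transpose_mul transpose_mat)
  then have "transpose P = P"
    by (metis WP matrix_mul_assoc matrix_mul_lid matrix_mul_rid)
  moreover have "0 < x \<bullet> (P *v x)" if "x \<noteq> 0" for x
  proof -
    have x: "W *v (P *v x) = x"
      by (simp add: matrix_vector_mul_assoc WP)
    then have "P *v x \<noteq> 0"
      using that by auto
    then have "0 < (P *v x) \<bullet> (W *v (P *v x))"
      using assms by (simp add: pos_def_def)
    then show ?thesis
      by (simp add: x inner_commute)
  qed
  ultimately have "pos_def P"
    by (simp add: pos_def_def sym_mats_def)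
  then show ?thesis
    using P WP by (rule that)
qed

(* A constant solution P of the Riccati equation: P is the inverse of the solution W of
   (A + c I) W + W (A + c I)\<^sup>T = B B\<^sup>T for large c, and Q = 2 c P. *)
lemma exists_pos_def_solution:
  fixes A :: "real^'n^'n" and B :: "real^'m^'n"
  assumes ctr: "controllable A B"
  obtains K Q where "pos_def Q" "Q \<in> solution_space A B T K"
proof -
  obtain a where a: "0 < a" "\<And>x. norm (A *v x) \<le> norm x * a"
    using bounded_linear.pos_bounded [OF matrix_vector_mul_bounded_linear [of A]] by blast
  \<comment> \<open>As \<open>a\<close> bounds the operator norm of \<open>A\<close>, the shift by
    \<open>a + 1\<close> makes the form of \<open>M\<close> at least the squared norm.\<close>
  define c where "c = a + 1"
  define M where "M = A + c *\<^sub>R mat 1"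
  have "0 < c"
    using a(1) by (simp add: c_def)
  have M: "x \<bullet> x \<le> x \<bullet> (M *v x)" for x
  proof -
    have "- (x \<bullet> (A *v x)) \<le> norm x * norm (A *v x)"
      using norm_cauchy_schwarz [of x "- (A *v x)"] by simp
    also have "\<dots> \<le> norm x * (norm x * a)"
      by (intro mult_left_mono a(2)) auto
    also have "\<dots> = a * (x \<bullet> x)"
      by (simp add: dot_square_norm power2_eq_square)
    finally show ?thesis
      by (simp add: M_def c_def matrix_vector_mult_bilinear inner_add_right algebra_simps)
  qed
  have "B ** transpose B \<in> sym_mats"
    by (simp add: sym_mats_def matrix_transpose_mul)
  then obtain W where W: "W \<in> sym_mats" "M ** W + W ** transpose M = B ** transpose B"
    using lyapunov_equation_solvable [OF M] by blast
  then have "pos_def W"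
    by (rule lyapunov_solution_pos_def [OF ctr M_def M])
  then obtain P where P: "pos_def P" "P ** W = mat 1" "W ** P = mat 1"
    by (rule pos_def_inverse)
  define Q where "Q = (2 * c) *\<^sub>R P"
  \<comment> \<open>Multiplying the Lyapunov equation by the inverse of \<open>W\<close> on both
    sides turns it into the algebraic Riccati equation; the shift contributes \<open>2 * c\<close>
    times \<open>P\<close>, which becomes the weight \<open>Q\<close>.\<close>
  have "P ** (M ** W + W ** transpose M) ** P = P ** M ** (W ** P) + P ** W ** (transpose M ** P)"
    by (simp only: matrix_mult_bilinear matrix_mul_assoc)
  then have "P ** (B ** transpose B) ** P = P ** M + transpose M ** P"
    by (simp add: W P)
  moreover have "Q = c *\<^sub>R P + c *\<^sub>R P"
    by (simp only: Q_def mult_2 scaleR_add_left)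
  then have "P ** M + transpose M ** P = P ** A + transpose A ** P + Q"
    by (simp add: M_def matrix_mult_bilinear transpose_linear)
  ultimately have "P ** A + transpose A ** P - P ** B ** transpose B ** P + Q = 0"
    by (simp add: matrix_mul_assoc)
  then have "is_DRE A B T Q P (\<lambda>t. - (transpose B ** P))"
    unfolding is_DRE_def solves_DRE_def by (intro exI [of _ "\<lambda>t. P"]) simp
  moreover have "pos_def Q"
    using P(1) \<open>0 < c\<close>
    by (simp add: Q_def pos_def_def matrix_vector_mult_bilinear subspace_scale [OF subspace_sym_mats])
  ultimately show ?thesis
    using P(1) by (intro that [of Q "\<lambda>t. - (transpose B ** P)"])
      (auto simp: solution_space_def intro: pos_def_imp_psd)
qed

text \<open>Zero feedback is the example of a singular weight that is the only solution.\<close>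

lemma zero_in_solution_space: "0 \<in> solution_space A B T (\<lambda>t. 0)"
proof -
  have "is_DRE A B T 0 0 (\<lambda>t. 0)"
    unfolding is_DRE_def solves_DRE_def
    by (intro exI [of _ "\<lambda>t. 0"]) (simp add: matrix_mult_bilinear)
  then show ?thesis
    by (auto simp: solution_space_def zero_in_psd_mats)
qed

text \<open>From a positive definite \<open>Q0\<close>, follow the ray in direction
  \<open>lyap A N\<close> with \<open>N = dyad w w\<close> to its last psd point. Since
  \<open>N\<close> is psd, \<open>F + s *\<^sub>R N\<close> stays psd all the way, so the end point
  is a solution; it is singular, and \<open>Q0\<close> is another solution for the same
  feedback.\<close>

lemma exists_singular_nonunique:
  fixes A :: "real^'n^'n" and B :: "real^'m^'n"
  assumes ctr: "controllable A B" and T: "0 < T" and rank: "rank B < CARD('n)"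
  obtains K Q where "rank Q < CARD('n)" "Q \<in> solution_space A B T K" "solution_space A B T K \<noteq> {Q}"
proof -
  obtain K Q0 where Q0: "pos_def Q0" "Q0 \<in> solution_space A B T K"
    using exists_pos_def_solution [OF ctr] .
  then obtain F where F: "Q0 \<in> psd_mats" "F \<in> psd_mats" "is_DRE A B T Q0 F K"
    by (auto simp: solution_space_def)
  obtain w where w: "w v* B = 0" "w \<noteq> 0"
    using left_kernel_nonzero [OF rank] .
  define N where "N = dyad w w"
  have N: "N \<in> null_sym B" "N \<in> psd_mats" "lyap A N \<noteq> 0"
    using w dyad_null_sym dyad_psd lyap_dyad_nonzero [OF ctr w] by (auto simp: N_def)
  then have "N \<noteq> 0"
    using linear_0 [OF linear_lyap] by metis
  define S where "S = {s. 0 \<le> s \<and> Q0 + s *\<^sub>R lyap A N \<in> psd_mats}"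
  obtain b where b: "\<And>M. M \<in> null_sym B \<Longrightarrow> Q0 + lyap A M \<in> psd_mats \<Longrightarrow> norm M \<le> b"
    using bounded_lyap_psd [OF ctr, of Q0] by (auto simp: bounded_iff)
  \<comment> \<open>The ray leaves the cone eventually, because admissible shifts are bounded in
    norm.\<close>
  have "s \<le> b / norm N" if "s \<in> S" for s
    using that b [of "s *\<^sub>R N"] subspace_scale [OF subspace_null_sym N(1), of s] \<open>N \<noteq> 0\<close>
    by (simp add: S_def linear_cmul [OF linear_lyap] field_simps)
  then have "S \<subseteq> {0..b / norm N}"
    by (auto simp: S_def)
  then have "bounded S"
    using bounded_closed_interval bounded_subset by blast
  moreover have "closed S"
  proof -
    have "closed ((\<lambda>s. Q0 + s *\<^sub>R lyap A N) -` psd_mats)"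
      by (intro continuous_closed_vimage closed_psd_mats continuous_intros)
    then have "closed ({0..} \<inter> (\<lambda>s. Q0 + s *\<^sub>R lyap A N) -` psd_mats)"
      by (intro closed_Int closed_atLeast)
    moreover have "S = {0..} \<inter> (\<lambda>s. Q0 + s *\<^sub>R lyap A N) -` psd_mats"
      by (auto simp: S_def)
    ultimately show ?thesis
      by simp
  qed
  moreover have "S \<noteq> {}"
    using F(1) by (auto simp: S_def intro: exI [of _ 0])
  ultimately obtain s where s: "s \<in> S" and max: "\<And>s'. s' \<in> S \<Longrightarrow> s' \<le> s"
    using compact_attains_sup compact_eq_bounded_closed by metis
  define Q where "Q = Q0 + s *\<^sub>R lyap A N"
  have "0 \<le> s" "Q \<in> psd_mats"
    using s by (auto simp: S_def Q_def)
  \<comment> \<open>Otherwise the ray could be prolonged beyond the maximal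
    \<open>s\<close>.\<close>
  have "\<not> pos_def Q"
  proof
    assume "pos_def Q"
    then obtain e where e: "0 < e" "Q + e *\<^sub>R lyap A N \<in> psd_mats"
      using pos_def_perturb [OF _ lyap_sym [of N A]] N(1) unfolding null_sym_def by blast
    then have "s + e \<in> S"
      using \<open>0 \<le> s\<close> by (simp add: S_def Q_def scaleR_add_left add.assoc)
    with max e(1) show False
      by force
  qed
  then have "rank Q < CARD('n)"
    using \<open>Q \<in> psd_mats\<close> psd_not_pos_def_rank by blast
  moreover have "Q \<in> solution_space A B T K"
    unfolding solution_space_eq [OF ctr T F]
  proof (rule image_eqI [of _ _ "s *\<^sub>R N"])
    show "Q = Q0 + lyap A (s *\<^sub>R N)"
      by (simp add: Q_def linear_cmul [OF linear_lyap])
    then show "s *\<^sub>R N \<in> {N \<in> null_sym B. Q0 + lyap A N \<in> psd_mats \<and> F + N \<in> psd_mats}"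
      using subspace_scale [OF subspace_null_sym N(1)] \<open>Q \<in> psd_mats\<close> F(2) N(2) \<open>0 \<le> s\<close>
      by (auto intro: psd_mats_add psd_mats_scaleR)
  qed
  moreover have "solution_space A B T K \<noteq> {Q}"
    using Q0 \<open>\<not> pos_def Q\<close> by auto
  ultimately show ?thesis
    by (rule that)
qed

section \<open>The semidefinite programming certificate\<close>

lemma spectral_dyads:
  "V ** diag_mat d ** transpose V = (\<Sum>i\<in>UNIV. d i *\<^sub>R dyad (column i V) (column i V))"
  by (simp add: vec_eq_iff matrix_matrix_mult_def diag_mat_def transpose_def dyad_def column_def
      if_distrib [of "\<lambda>x. _ * x"] mult_ac cong: if_cong)

lemma trace_mult_spectral:
  "trace (M ** (V ** diag_mat d ** transpose V)) = (\<Sum>i\<in>UNIV. d i * (column i V \<bullet> (M *v column i V)))"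
proof -
  have lin: "linear (\<lambda>X. trace (M ** X))"
    by (intro linearI)
      (simp_all add: trace_def matrix_mult_bilinear sum.distrib sum_distrib_left)
  have "trace (M ** dyad a b) = b \<bullet> (M *v a)" for a b
    by (simp add: trace_def matrix_matrix_mult_def dyad_def matrix_vector_mult_def inner_vec_def
        sum_distrib_left mult_ac)
  then show ?thesis
    unfolding spectral_dyads linear_sum [OF lin] linear_cmul [OF lin] by simp
qed

text \<open>Complementary slackness: all solutions have the same trace against \<open>X\<close>,
  because their differences are orthogonal to it. That trace is at most 0, yet it is a sum of
  nonnegative terms, so every solution kills the columns of \<open>V\<close> indexed by
  \<open>I\<close>. Differences of solutions thus land in \<open>block_space V I\<close>.\<close>

lemma sdp_certificate_unique:
  fixes A :: "real^'n^'n" and V :: "real^'n^'n"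
  assumes ctr: "controllable A B" and T: "0 < T" and Qbar: "Qbar \<in> solution_space A B T K"
    and basis: "is_basis r G (difference_space A B)" and opt: "sdp_optimal Qbar r G X"
    and V: "orthogonal_matrix V" and I: "card I = rank X" "\<And>i. i \<notin> I \<Longrightarrow> d i = 0"
    and X: "X = V ** diag_mat d ** transpose V"
    and trivial: "block_space V I \<inter> difference_space A B = {0}"
  shows "solution_space A B T K = {Qbar}"
proof -
  define v where "v i = column i V" for i
  have v_orth: "v i \<bullet> v j = (if i = j then 1 else 0)" for i j
    using V by (auto simp: v_def orthogonal_matrix_orthonormal_columns norm_eq_1 orthogonal_def)
  have X_dyads: "X = (\<Sum>i\<in>UNIV. d i *\<^sub>R dyad (v i) (v i))"
    by (simp add: X v_def spectral_dyads)
  have X_apply: "X *v x = (\<Sum>i\<in>UNIV. (d i * (v i \<bullet> x)) *\<^sub>R v i)" for x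
    unfolding X_dyads
    by (simp add: bounded_bilinear.sum_left [OF bounded_bilinear_matrix_vector_mult]
        matrix_vector_mult_bilinear dyad_mult_vec)
  have tr: "trace (M ** X) = (\<Sum>i\<in>UNIV. d i * (v i \<bullet> (M *v v i)))" for M
    by (simp add: X v_def trace_mult_spectral)
  have feasible: "X \<in> psd_mats" "\<And>i. i \<in> {1..r} \<Longrightarrow> trace (G i ** X) = 0"
    using opt by (auto simp: sdp_optimal_def sdp_feasible_def)
  have "d i = v i \<bullet> (X *v v i)" for i
    by (simp only: X_apply inner_sum_right inner_scaleR_right v_orth)
      (simp add: if_distrib cong: if_cong)
  then have d: "0 \<le> d i" for i
    using feasible(1) by (simp add: psd_mats_def)
  \<comment> \<open>The range of \<open>X\<close> is spanned by the columns with nonzero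
    \<open>d i\<close>, so there are at least \<open>rank X\<close> of them; as
    \<open>card I = rank X\<close>, they fill \<open>I\<close>.\<close>
  have d_I: "d i \<noteq> 0" if "i \<in> I" for i
  proof -
    have "X *v x \<in> span (v ` {i. d i \<noteq> 0})" for x
      unfolding X_apply
    proof (rule span_sum)
      fix i
      show "(d i * (v i \<bullet> x)) *\<^sub>R v i \<in> span (v ` {i. d i \<noteq> 0})"
        by (cases "d i = 0") (auto intro: span_zero span_base span_scale)
    qed
    then have "range ((*v) X) \<subseteq> span (v ` {i. d i \<noteq> 0})"
      by auto
    then have "rank X \<le> card (v ` {i. d i \<noteq> 0})"
      unfolding rank_dim_range by (intro dim_le_card) auto
    also have "\<dots> \<le> card {i. d i \<noteq> 0}"
      by (rule card_image_le) auto
    finally have "card I \<le> card {i. d i \<noteq> 0}"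
      by (simp add: I)
    moreover have "{i. d i \<noteq> 0} \<subseteq> I"
      using I(2) by blast
    ultimately have "{i. d i \<noteq> 0} = I"
      by (intro card_seteq) auto
    with that show ?thesis
      by blast
  qed
  have tr_diff: "trace (M ** X) = 0" if "M \<in> difference_space A B" for M
  proof -
    have "subspace {M. trace (M ** X) = 0}"
      by (auto simp: subspace_def trace_def matrix_mult_bilinear sum.distrib simp flip: sum_distrib_left)
    moreover have "G ` {1..r} \<subseteq> {M. trace (M ** X) = 0}"
      using feasible(2) by auto
    ultimately have "span (G ` {1..r}) \<subseteq> {M. trace (M ** X) = 0}"
      by (intro span_minimal)
    then show ?thesis
      using basis that by (auto simp: is_basis_def)
  qed
  \<comment> \<open>The zero matrix competes in the minimization, so the optimal value is at most
    0.\<close>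
  have "0 \<in> sdp_feasible r G"
    by (simp add: sdp_feasible_def zero_in_psd_mats matrix_mult_bilinear trace_def)
  then have "trace (Qbar ** X) \<le> trace (Qbar ** 0)"
    using opt unfolding sdp_optimal_def by blast
  then have tr_Qbar: "trace (Qbar ** X) \<le> 0"
    by (simp add: matrix_mult_bilinear trace_def)
  have null: "Q *v v i = 0" if Q: "Q \<in> solution_space A B T K" and i: "i \<in> I" for Q i
  proof -
    have psd: "Q \<in> psd_mats"
      using Q by (simp add: solution_space_def)
    have "trace ((Q - Qbar) ** X) = 0"
      by (intro tr_diff solution_space_diff [OF ctr T Qbar Q])
    then have "trace (Q ** X) \<le> 0"
      using tr_Qbar by (simp add: matrix_mult_bilinear trace_def sum_subtractf)
    moreover have nonneg: "0 \<le> d i * (v i \<bullet> (Q *v v i))" for i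
      using psd d by (simp add: psd_mats_def)
    ultimately have "(\<Sum>i\<in>UNIV. d i * (v i \<bullet> (Q *v v i))) = 0"
      unfolding tr by (intro antisym sum_nonneg)
    then have "d i * (v i \<bullet> (Q *v v i)) = 0"
      by (simp only: sum_nonneg_eq_0_iff [OF finite_class.finite_UNIV nonneg]) blast
    then show ?thesis
      using d_I [OF i] by (intro psd_mats_null [OF psd]) simp
  qed
  have "Q = Qbar" if Q: "Q \<in> solution_space A B T K" for Q
  proof -
    define D where "D = Q - Qbar"
    \<comment> \<open>The matrix of \<open>D\<close> in the orthonormal basis of the columns of
      \<open>V\<close>.\<close>
    define M where "M = transpose V ** D ** V"
    have D: "D \<in> difference_space A B"
      unfolding D_def by (rule solution_space_diff [OF ctr T Qbar Q])
    have symD: "D \<in> sym_mats"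
      using Q Qbar subspace_diff [OF subspace_sym_mats]
      by (auto simp: D_def solution_space_def psd_mats_def)
    have Dv: "D *v v i = 0" if "i \<in> I" for i
      using null [OF Q that] null [OF Qbar that] by (simp add: D_def matrix_vector_mult_bilinear)
    have "M $ i $ j = v i \<bullet> (D *v v j)" for i j
      by (simp add: M_def v_def matrix_matrix_mult_def matrix_vector_mult_def transpose_def column_def
          inner_vec_def sum_distrib_left sum_distrib_right mult_ac)
        (subst sum.swap, simp add: mult_ac)
    then have M0: "M $ i $ j = 0" if "i \<in> I \<or> j \<in> I" for i j
      using that Dv sym_mats_inner_commute [OF symD, of "v i" "v j"] by auto
    have "M \<in> sym_mats"
      using symD by (simp add: M_def sym_mats_def matrix_transpose_mul matrix_mul_assoc)
    moreover have "V ** M ** transpose V = D"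
    proof -
      have "V ** M ** transpose V = (V ** transpose V) ** D ** (V ** transpose V)"
        by (simp add: M_def matrix_mul_assoc)
      then show ?thesis
        using V by (simp add: orthogonal_matrix_def)
    qed
    ultimately have "D \<in> block_space V I"
      using M0 unfolding block_space_def by blast
    with D trivial have "D = 0"
      by blast
    then show ?thesis
      by (simp add: D_def)
  qed
  with Qbar show ?thesis
    by blast
qed

text \<open>Dimension \<open>r\<close> is read as the dimension of the difference space, attained by
  the affine dimension once a positive definite solution exists: for \<open>Qbar = 0\<close> and
  \<open>m < n\<close> the solution space is a single point although \<open>r > 0\<close>. For
  \<open>m = n\<close> the difference space is zero and every solution is unique, hence the
  condition \<open>CARD('m) < CARD('n)\<close> on infinitude and on non-uniqueness. Dependence on
  the position of a singular weight is rendered by examples of both kinds.\<close>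

theorem theorem13:
  fixes A :: "real ^ 'n ^ 'n"
    and B :: "real ^ 'm ^ 'n"
    and T :: real
    and K :: "real \<Rightarrow> real ^ 'n ^ 'm"
    and Qbar :: "real ^ 'n ^ 'n"
    and r :: nat
  assumes "controllable A B"
    and "rank B = CARD('m)"
    and "0 < T"
    and "Qbar \<in> solution_space A B T K"
    and "r = (CARD('n) - CARD('m)) * (CARD('n) - CARD('m) + 1) div 2"
  shows
    "(closed (solution_space A B T K) \<and> bounded (solution_space A B T K) \<and>
      convex (solution_space A B T K) \<and>
      subspace (difference_space A B) \<and> dim (difference_space A B) = r \<and>
      solution_space A B T K \<subseteq> {Qbar + \<Delta>Q | \<Delta>Q. \<Delta>Q \<in> difference_space A B} \<and>
      aff_dim (solution_space A B T K) \<le> int r \<and>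
      ((\<exists>Q \<in> solution_space A B T K. pos_def Q) \<longrightarrow>
         aff_dim (solution_space A B T K) = int r) \<and>
      (\<forall>Q1 \<in> solution_space A B T K. \<forall>Q2 \<in> solution_space A B T K. Q1 \<noteq> Q2 \<longrightarrow>
         indefinite (Q1 - Q2) \<and>
         (\<exists>c. eigenvalue (Q1 - Q2) c \<and> 0 < c) \<and> (\<exists>c. eigenvalue (Q1 - Q2) c \<and> c < 0)))
     \<and>
     (Qbar = 0 \<longrightarrow> solution_space A B T K = {Qbar})
     \<and>
     (CARD('m) < CARD('n) \<longrightarrow> pos_def Qbar \<longrightarrow> infinite (solution_space A B T K))
     \<and>
     ((\<exists>K' Q'. rank Q' < CARD('n) \<and> solution_space A B T K' = {Q'}) \<and>
      (CARD('m) < CARD('n) \<longrightarrow>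
         (\<exists>K' Q'. rank Q' < CARD('n) \<and> Q' \<in> solution_space A B T K' \<and>
            solution_space A B T K' \<noteq> {Q'})))
     \<and>
     (rank Qbar < CARD('n) \<longrightarrow>
      (\<forall>\<Delta>Q X V I d.
         is_basis r \<Delta>Q (difference_space A B) \<longrightarrow>
         sdp_optimal Qbar r \<Delta>Q X \<longrightarrow> X \<noteq> 0 \<longrightarrow>
         orthogonal_matrix V \<longrightarrow> card I = rank X \<longrightarrow> (\<forall>i. i \<notin> I \<longrightarrow> d i = 0) \<longrightarrow>
         X = V ** diag_mat d ** transpose V \<longrightarrow>
         block_space V I \<inter> difference_space A B = {0} \<longrightarrow>
         solution_space A B T K = {Qbar}))"
proof (intro conjI)
  note ctr = assms(1) and T = assms(3) and Qbar = assms(4)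
  obtain F where F: "Qbar \<in> psd_mats" "F \<in> psd_mats" "is_DRE A B T Qbar F K"
    using Qbar by (auto simp: solution_space_def)
  note top = solution_space_topology [OF ctr T F]
  show "closed (solution_space A B T K)" "bounded (solution_space A B T K)"
    using top(1) by (simp_all add: compact_imp_closed compact_imp_bounded)
  show "convex (solution_space A B T K)"
    by (rule top(2))
  show "subspace (difference_space A B)"
    by (rule subspace_difference_space)
  show dim: "dim (difference_space A B) = r"
    by (simp add: dim_difference_space [OF ctr] assms)
  show "solution_space A B T K \<subseteq> {Qbar + \<Delta>Q | \<Delta>Q. \<Delta>Q \<in> difference_space A B}"
  proof
    fix Q assume "Q \<in> solution_space A B T K"
    then have "Q = Qbar + (Q - Qbar)" "Q - Qbar \<in> difference_space A B"
      using solution_space_diff [OF ctr T Qbar] by auto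
    then show "Q \<in> {Qbar + \<Delta>Q | \<Delta>Q. \<Delta>Q \<in> difference_space A B}"
      by blast
  qed
  show "aff_dim (solution_space A B T K) \<le> int r"
    using aff_dim_solution_space_le [OF ctr T Qbar] by (simp add: dim)
  show "(\<exists>Q \<in> solution_space A B T K. pos_def Q) \<longrightarrow>
      aff_dim (solution_space A B T K) = int r"
    using aff_dim_solution_space_pos_def [OF ctr T] by (auto simp: dim)
  show "\<forall>Q1 \<in> solution_space A B T K. \<forall>Q2 \<in> solution_space A B T K. Q1 \<noteq> Q2 \<longrightarrow>
      indefinite (Q1 - Q2) \<and>
      (\<exists>c. eigenvalue (Q1 - Q2) c \<and> 0 < c) \<and> (\<exists>c. eigenvalue (Q1 - Q2) c \<and> c < 0)"
  proof (intro ballI impI)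
    fix Q1 Q2 assume "Q1 \<in> solution_space A B T K" "Q2 \<in> solution_space A B T K" "Q1 \<noteq> Q2"
    then have "indefinite (Q1 - Q2)"
      by (intro difference_space_indefinite [OF ctr] solution_space_diff [OF ctr T]) auto
    then show "indefinite (Q1 - Q2) \<and>
      (\<exists>c. eigenvalue (Q1 - Q2) c \<and> 0 < c) \<and> (\<exists>c. eigenvalue (Q1 - Q2) c \<and> c < 0)"
      using indefinite_eigenvalues by blast
  qed
  show "Qbar = 0 \<longrightarrow> solution_space A B T K = {Qbar}"
    using solution_space_zero [OF ctr T] Qbar by auto
  show "CARD('m) < CARD('n) \<longrightarrow> pos_def Qbar \<longrightarrow> infinite (solution_space A B T K)"
    using infinite_solution_space [OF ctr T Qbar] by (simp add: assms(2))
  show "\<exists>K' Q'. rank Q' < CARD('n) \<and> solution_space A B T K' = {Q'}"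
    using solution_space_zero [OF ctr T zero_in_solution_space]
    by (intro exI [of _ "\<lambda>t. 0"] exI [of _ 0]) simp
  show "CARD('m) < CARD('n) \<longrightarrow>
      (\<exists>K' Q'. rank Q' < CARD('n) \<and> Q' \<in> solution_space A B T K' \<and>
        solution_space A B T K' \<noteq> {Q'})"
    using exists_singular_nonunique [OF ctr T] by (metis assms(2))
  show "rank Qbar < CARD('n) \<longrightarrow>
      (\<forall>\<Delta>Q X V I d.
         is_basis r \<Delta>Q (difference_space A B) \<longrightarrow>
         sdp_optimal Qbar r \<Delta>Q X \<longrightarrow> X \<noteq> 0 \<longrightarrow>
         orthogonal_matrix V \<longrightarrow> card I = rank X \<longrightarrow> (\<forall>i. i \<notin> I \<longrightarrow> d i = 0) \<longrightarrow>
         X = V ** diag_mat d ** transpose V \<longrightarrow>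
         block_space V I \<inter> difference_space A B = {0} \<longrightarrow>
         solution_space A B T K = {Qbar})"
    using sdp_certificate_unique [OF ctr T Qbar] by blast
qed

end
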